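(* Let $H$ be a Hopf algebra with bijective antipode over a field $k$, let $A$ be a principal right $H$-comodule algebra, and let $B=A^{\mathrm{co}(H)}\subset A$ (a Hopf--Galois extension). Let $I_H\subseteq H^+=\ker\varepsilon$ be a right ideal of $H$ invariant under the right adjoint coaction, and let $\omega:H^+\to\Omega^1_{\mathrm u}(A)$ be the connection 1-form associated to a strong connection on $A$. Assume that there exists a right $H$-colinear splitting map $s:A\otimes_BA\to\Omega^1_{\mathrm u}(A)$, i.e. $\pi\circ s=\mathrm{id}_{A\otimes_BA}$, such that $$\mathrm{ver}_{\mathrm u}\bigl(s(\langle\pi(\omega(I_H))\rangle_\sigma)\bigr)\subseteq A\otimes I_H.$$ Let $$N_A:=A\cdot s(\langle\pi(\omega(I_H))\rangle_\sigma)\cdot A+A\,\Omega^1_{\mathrm u}(B)\,A,\qquad \Omega^1(A)=\Omega^1_{\mathrm u}(A)/N_A$$ be the corresponding $\sigma$-generated differential calculus. Then the vertical map $\mathrm{ver}_{\mathrm u}$ descends to a well-defined surjective map $$\mathrm{ver}:\Omega^1(A)\to A\otimes H^+/I_H,$$ that is, $\mathrm{ver}\circ q_{N_A}=(\mathrm{id}_A\otimes q_{I_H})\circ\mathrm{ver}_{\mathrm u}$, where $q_{N_A}:\Omega^1_{\mathrm u}(A)\to\Omega^1(A)$ and $q_{I_H}:H^+\to H^+/I_H$ are the canonical quotient maps.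
   Context: All spaces are over a field $k$; algebras are associative and unital; $H$ is a Hopf algebra with coproduct $\Delta$, counit $\varepsilon$, bijective antipode $S$; $H^+=\ker\varepsilon$ and $h^+:=h-\varepsilon(h)1_H$. Sweedler notation is used. $\mathrm{Ad}_R(h)=h_{(2)}\otimes S(h_{(1)})h_{(3)}$ is the right adjoint coaction; $I_H$ invariant means $\mathrm{Ad}_R(I_H)\subset I_H\otimes H$. Hopf--Galois extension: $A$ is a right $H$-comodule algebra with coaction $\delta(a)=a_{(0)}\otimes a_{(1)}$, $B=A^{\mathrm{co}(H)}=\{b\in A:\delta(b)=b\otimes 1\}$, and $B\subset A$ is Hopf--Galois if $\mathrm{can}:A\otimes_BA\to A\otimes H$, $\mathrm{can}(a\otimes_Ba')=aa'_{(0)}\otimes a'_{(1)}$, is bijective. Translation map: $\tau(h)=\mathrm{can}^{-1}(1\otimes h)=h^{\langle1\rangle}\otimes_Bh^{\langle2\rangle}$. $A$ is principal if $B\subset A$ is Hopf--Galois and the multiplication $B\otimes A\to A$ has a left $B$-linear, right $H$-colinear splitting. Universal calculus: $\Omega^1_{\mathrm u}(A)=\ker(m:A\otimes A\to A)$, $\mathrm d_{\mathrm u}(a)=1\otimes a-a\otimes 1$; similarly $\Omega^1_{\mathrm u}(B)$, regarded inside $\Omega^1_{\mathrm u}(A)$. $A\otimes A$, $\Omega^1_{\mathrm u}(A)$ and $A\otimes_BA$ carry the diagonal right $H$-coaction $a\otimes a'\mapsto a_{(0)}\otimes a'_{(0)}\otimes a_{(1)}a'_{(1)}$. $\pi:A\otimes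 A\to A\otimes_BA$ is the canonical quotient map, also denoted $\pi$ when restricted to $\Omega^1_{\mathrm u}(A)$. The vertical map is $\mathrm{ver}_{\mathrm u}:\Omega^1_{\mathrm u}(A)\to A\otimes H^+$, $\mathrm{ver}_{\mathrm u}(a\otimes a')=aa'_{(0)}\otimes(a'_{(1)})^+$. Durdević braiding: $\sigma:A\otimes_BA\to A\otimes_BA$, $\sigma(a\otimes_Ba')=a_{(0)}a'(a_{(1)})^{\langle1\rangle}\otimes_B(a_{(1)})^{\langle2\rangle}$ (a bijection). A subspace $V$ is $\sigma$-stable if $\sigma(V)=V$; $\langle W\rangle_\sigma$ is the smallest $\sigma$-stable subspace of $A\otimes_BA$ containing $W$. For a subspace $X$ of an $A$-bimodule, $A\cdot X\cdot A$ is the subbimodule it generates. Strong connection: a linear map $\ell:H\to A\otimes A$ with $\ell(1_H)=1\otimes1$, $(\mathrm{id}\otimes\delta)\circ\ell=(\ell\otimes\mathrm{id})\circ\Delta$, and $\widetilde{\mathrm{can}}\circ\ell=1_A\otimes\mathrm{id}_H$ where $\widetilde{\mathrm{can}}(a\otimes a')=aa'_{(0)}\otimes a'_{(1)}$. Associated connection 1-form: $\omega:H^+\to\Omega^1_{\mathrm u}(A)$, $\omega(h^+)=\ell(h)-\varepsilon(h)1\otimes1$; the definition of connection 1-form includes the properties $\mathrm{ver}_{\mathrm u}\circ\omega=1_A\otimes\mathrm{id}_{H^+}$ and $\delta_{\Omega^1_{\mathrm u}(A)}\circ\omega=(\omega\otimes\mathrm{id}_H)\circ\mathrm{Ad}_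R$.
   Formalization: A right inverse s of π on all of A⊗_B A with values in Ω¹_u(A) forces A=0 (apply multiplication), so s is instead taken as a right H-colinear splitting A⊗_B A → A⊗A of π that maps ⟨π(ω(I_H))⟩_σ into Ω¹_u(A); a splitting over the kernel of multiplication is covered. *)

theory Defs
  imports "HOL-Algebra.Module" "HOL-Algebra.AbelCoset"
begin

section \<open>Linear algebra over a field\<close>

text \<open>Vector spaces over \<^term>\<open>K\<close> are the library's modules over a field, and subspaces are
  its submodules.\<close>

definition lin ::
  "('k, 'm) ring_scheme \<Rightarrow> ('k, 'v, 'p) module_scheme \<Rightarrow> ('k, 'w, 'q) module_scheme \<Rightarrow> ('v \<Rightarrow> 'w) set"
  where "lin K V W = {f \<in> carrier V \<rightarrow> carrier W.
     (\<forall>x \<in> carrier V. \<forall>y \<in> carrier V. f (x \<oplus>\<^bsub>V\<^esub> y) = f x \<oplus>\<^bsub>W\<^esub> f y) \<and>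
     (\<forall>c \<in> carrier K. \<forall>x \<in> carrier V. f (c \<odot>\<^bsub>V\<^esub> x) = c \<odot>\<^bsub>W\<^esub> f x)}"

definition ground :: "('k, 'm) ring_scheme \<Rightarrow> ('k, 'k) module"
  where "ground K = \<lparr>carrier = carrier K, mult = mult K, one = one K,
     zero = zero K, add = add K, smult = mult K\<rparr>"

definition lspan :: "('k, 'm) ring_scheme \<Rightarrow> ('k, 'v, 'p) module_scheme \<Rightarrow> 'v set \<Rightarrow> 'v set"
  where "lspan K V X = \<Inter>{U. submodule U K V \<and> X \<subseteq> U}"

abbreviation on_sub :: "('k, 'v, 'p) module_scheme \<Rightarrow> 'v set \<Rightarrow> ('k, 'v, 'p) module_scheme"
  where "on_sub V U \<equiv> V\<lparr>carrier := U\<rparr>"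

text \<open>The quotient space \<open>V/U\<close>, consisting of cosets. The ring fields of the record are
  irrelevant for a vector space and stay unspecified.\<close>

definition quot :: "('k, 'v, 'p) module_scheme \<Rightarrow> 'v set \<Rightarrow> ('k, 'v set) module"
  where "quot V U = \<lparr>carrier = a_rcosets\<^bsub>V\<^esub> U, mult = undefined, one = undefined,
     zero = U, add = set_add V, smult = (\<lambda>c X. U <+>\<^bsub>V\<^esub> ((\<lambda>x. c \<odot>\<^bsub>V\<^esub> x) ` X))\<rparr>"

definition qmap :: "('k, 'v, 'p) module_scheme \<Rightarrow> 'v set \<Rightarrow> 'v \<Rightarrow> 'v set"
  where "qmap V U x = U +>\<^bsub>V\<^esub> x"

text \<open>The map on \<open>V/U\<close> induced by a map \<^term>\<open>f\<close> on \<open>V\<close> that is constant on cosets of \<open>U\<close>.\<close>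

definition qlift :: "('k, 'v, 'p) module_scheme \<Rightarrow> 'v set \<Rightarrow> ('v \<Rightarrow> 'w) \<Rightarrow> 'v set \<Rightarrow> 'w"
  where "qlift V U f = (\<lambda>X \<in> carrier (quot V U). the_elem (f ` X))"


section \<open>Tensor products over a field\<close>

definition free_mod :: "('k, 'm) ring_scheme \<Rightarrow> 'x set \<Rightarrow> ('k, 'x \<Rightarrow> 'k) module"
  where "free_mod K X = \<lparr>
     carrier = {f. (\<forall>x \<in> X. f x \<in> carrier K) \<and> (\<forall>x. x \<notin> X \<longrightarrow> f x = \<zero>\<^bsub>K\<^esub>) \<and> finite {x. f x \<noteq> \<zero>\<^bsub>K\<^esub>}},
     mult = undefined, one = undefined,
     zero = (\<lambda>_. \<zero>\<^bsub>K\<^esub>), add = (\<lambda>f g x. f x \<oplus>\<^bsub>K\<^esub> g x), smult = (\<lambda>c f x. c \<otimes>\<^bsub>K\<^esub> f x)\<rparr>"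

definition free_gen :: "('k, 'm) ring_scheme \<Rightarrow> 'x \<Rightarrow> 'x \<Rightarrow> 'k"
  where "free_gen K x = (\<lambda>y. if y = x then \<one>\<^bsub>K\<^esub> else \<zero>\<^bsub>K\<^esub>)"

definition tensor_rels ::
  "('k, 'm) ring_scheme \<Rightarrow> ('k, 'v, 'p) module_scheme \<Rightarrow> ('k, 'w, 'q) module_scheme \<Rightarrow> ('v \<times> 'w \<Rightarrow> 'k) set"
  where "tensor_rels K V W = (let F = free_mod K (carrier V \<times> carrier W); g = free_gen K in
     lspan K F
      ({g (x \<oplus>\<^bsub>V\<^esub> x', y) \<ominus>\<^bsub>F\<^esub> (g (x, y) \<oplus>\<^bsub>F\<^esub> g (x', y)) | x x' y.
          x \<in> carrier V \<and> x' \<in> carrier V \<and> y \<in> carrier W} \<union>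
       {g (x, y \<oplus>\<^bsub>W\<^esub> y') \<ominus>\<^bsub>F\<^esub> (g (x, y) \<oplus>\<^bsub>F\<^esub> g (x, y')) | x y y'.
          x \<in> carrier V \<and> y \<in> carrier W \<and> y' \<in> carrier W} \<union>
       {g (c \<odot>\<^bsub>V\<^esub> x, y) \<ominus>\<^bsub>F\<^esub> (c \<odot>\<^bsub>F\<^esub> g (x, y)) | c x y.
          c \<in> carrier K \<and> x \<in> carrier V \<and> y \<in> carrier W} \<union>
       {g (x, c \<odot>\<^bsub>W\<^esub> y) \<ominus>\<^bsub>F\<^esub> (c \<odot>\<^bsub>F\<^esub> g (x, y)) | c x y.
          c \<in> carrier K \<and> x \<in> carrier V \<and> y \<in> carrier W}))"

type_synonym ('k, 'v, 'w) tens = "('v \<times> 'w \<Rightarrow> 'k) set"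

definition tensor ::
  "('k, 'm) ring_scheme \<Rightarrow> ('k, 'v, 'p) module_scheme \<Rightarrow> ('k, 'w, 'q) module_scheme
   \<Rightarrow> ('k, ('k, 'v, 'w) tens) module"
  where "tensor K V W = quot (free_mod K (carrier V \<times> carrier W)) (tensor_rels K V W)"

definition pure ::
  "('k, 'm) ring_scheme \<Rightarrow> ('k, 'v, 'p) module_scheme \<Rightarrow> ('k, 'w, 'q) module_scheme
   \<Rightarrow> 'v \<Rightarrow> 'w \<Rightarrow> ('k, 'v, 'w) tens"
  where "pure K V W x y =
     qmap (free_mod K (carrier V \<times> carrier W)) (tensor_rels K V W) (free_gen K (x, y))"

text \<open>\<^term>\<open>tlift K V W U \<beta>\<close> is the linear map \<open>V \<otimes> W \<rightarrow> U\<close> with \<open>x \<otimes> y \<mapsto> \<beta> x y\<close>, for bilinear \<open>\<beta>\<close>.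
  An expression in Sweedler notation \<open>\<beta>(h\<^sub>(\<^sub>1\<^sub>), h\<^sub>(\<^sub>2\<^sub>))\<close> is this lift applied to \<open>\<Delta>(h)\<close>.\<close>

definition tlift ::
  "('k, 'm) ring_scheme \<Rightarrow> ('k, 'v, 'p) module_scheme \<Rightarrow> ('k, 'w, 'q) module_scheme
   \<Rightarrow> ('k, 'u, 'r) module_scheme \<Rightarrow> ('v \<Rightarrow> 'w \<Rightarrow> 'u) \<Rightarrow> ('k, 'v, 'w) tens \<Rightarrow> 'u"
  where "tlift K V W U \<beta> =
     qlift (free_mod K (carrier V \<times> carrier W)) (tensor_rels K V W)
       (\<lambda>f. \<Oplus>\<^bsub>U\<^esub>p \<in> {p. f p \<noteq> \<zero>\<^bsub>K\<^esub>}. f p \<odot>\<^bsub>U\<^esub> \<beta> (fst p) (snd p))"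

definition tmap ::
  "('k, 'm) ring_scheme \<Rightarrow> ('k, 'v, 'p) module_scheme \<Rightarrow> ('k, 'w, 'q) module_scheme
   \<Rightarrow> ('k, 'v1, 'p1) module_scheme \<Rightarrow> ('k, 'w1, 'q1) module_scheme
   \<Rightarrow> ('v \<Rightarrow> 'v1) \<Rightarrow> ('w \<Rightarrow> 'w1) \<Rightarrow> ('k, 'v, 'w) tens \<Rightarrow> ('k, 'v1, 'w1) tens"
  where "tmap K V W V1 W1 f g = tlift K V W (tensor K V1 W1) (\<lambda>x y. pure K V1 W1 (f x) (g y))"

definition tassoc ::
  "('k, 'm) ring_scheme \<Rightarrow> ('k, 'v, 'p) module_scheme \<Rightarrow> ('k, 'w, 'q) module_scheme
   \<Rightarrow> ('k, 'u, 'r) module_scheme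
   \<Rightarrow> ('k, ('k, 'v, 'w) tens, 'u) tens \<Rightarrow> ('k, 'v, ('k, 'w, 'u) tens) tens"
  where "tassoc K V W U = (let T = tensor K V (tensor K W U) in
     tlift K (tensor K V W) U T
       (\<lambda>t z. tlift K V W T (\<lambda>x y. pure K V (tensor K W U) x (pure K W U y z)) t))"

text \<open>For subspaces \<open>X\<close> of \<open>V\<close> and \<open>Y\<close> of \<open>W\<close>: the subspace \<open>X \<otimes> Y\<close> of \<open>V \<otimes> W\<close>.\<close>

definition tsub ::
  "('k, 'm) ring_scheme \<Rightarrow> ('k, 'v, 'p) module_scheme \<Rightarrow> ('k, 'w, 'q) module_scheme
   \<Rightarrow> 'v set \<Rightarrow> 'w set \<Rightarrow> ('k, 'v, 'w) tens set"
  where "tsub K V W X Y = lspan K (tensor K V W) {pure K V W x y | x y. x \<in> X \<and> y \<in> Y}"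

definition tmult ::
  "('k, 'm) ring_scheme \<Rightarrow> ('k, 'v, 'p) module_scheme \<Rightarrow> ('k, 'w, 'q) module_scheme
   \<Rightarrow> ('k, 'v, 'w) tens \<Rightarrow> ('k, 'v, 'w) tens \<Rightarrow> ('k, 'v, 'w) tens"
  where "tmult K V W s t = (let T = tensor K V W in
     tlift K V W T (\<lambda>x y. tlift K V W T (\<lambda>x' y'. pure K V W (x \<otimes>\<^bsub>V\<^esub> x') (y \<otimes>\<^bsub>W\<^esub> y')) t) s)"


section \<open>Hopf algebras\<close>

text \<open>The library's locale \<open>algebra\<close> is restricted to commutative algebras.\<close>

definition k_algebra :: "('k, 'm) ring_scheme \<Rightarrow> ('k, 'a, 'p) module_scheme \<Rightarrow> bool"
  where "k_algebra K A \<longleftrightarrow> module K A \<and> ring A \<and>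
     (\<forall>c \<in> carrier K. \<forall>x \<in> carrier A. \<forall>y \<in> carrier A.
        (c \<odot>\<^bsub>A\<^esub> x) \<otimes>\<^bsub>A\<^esub> y = c \<odot>\<^bsub>A\<^esub> (x \<otimes>\<^bsub>A\<^esub> y) \<and> x \<otimes>\<^bsub>A\<^esub> (c \<odot>\<^bsub>A\<^esub> y) = c \<odot>\<^bsub>A\<^esub> (x \<otimes>\<^bsub>A\<^esub> y))"

record ('k, 'h) hopf = "('k, 'h) module" +
  comult :: "'h \<Rightarrow> ('h \<times> 'h \<Rightarrow> 'k) set"
  counit :: "'h \<Rightarrow> 'k"
  antipode :: "'h \<Rightarrow> 'h"

definition coalgebra :: "('k, 'm) ring_scheme \<Rightarrow> ('k, 'h) hopf \<Rightarrow> bool"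
  where "coalgebra K H \<longleftrightarrow>
     comult H \<in> lin K H (tensor K H H) \<and>
     counit H \<in> lin K H (ground K) \<and>
     (\<forall>h \<in> carrier H.
        tassoc K H H H (tmap K H H (tensor K H H) H (comult H) id (comult H h))
          = tmap K H H H (tensor K H H) id (comult H) (comult H h) \<and>
        tlift K H H H (\<lambda>h1 h2. counit H h1 \<odot>\<^bsub>H\<^esub> h2) (comult H h) = h \<and>
        tlift K H H H (\<lambda>h1 h2. counit H h2 \<odot>\<^bsub>H\<^esub> h1) (comult H h) = h)"

definition bialgebra :: "('k, 'm) ring_scheme \<Rightarrow> ('k, 'h) hopf \<Rightarrow> bool"
  where "bialgebra K H \<longleftrightarrow> k_algebra K H \<and> coalgebra K H \<and>
     comult H \<one>\<^bsub>H\<^esub> = pure K H H \<one>\<^bsub>H\<^esub> \<one>\<^bsub>H\<^esub> \<and>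
     counit H \<one>\<^bsub>H\<^esub> = \<one>\<^bsub>K\<^esub> \<and>
     (\<forall>g \<in> carrier H. \<forall>h \<in> carrier H.
        comult H (g \<otimes>\<^bsub>H\<^esub> h) = tmult K H H (comult H g) (comult H h) \<and>
        counit H (g \<otimes>\<^bsub>H\<^esub> h) = counit H g \<otimes>\<^bsub>K\<^esub> counit H h)"

definition hopf_algebra :: "('k, 'm) ring_scheme \<Rightarrow> ('k, 'h) hopf \<Rightarrow> bool"
  where "hopf_algebra K H \<longleftrightarrow> bialgebra K H \<and> antipode H \<in> lin K H H \<and>
     (\<forall>h \<in> carrier H.
        tlift K H H H (\<lambda>h1 h2. antipode H h1 \<otimes>\<^bsub>H\<^esub> h2) (comult H h) = counit H h \<odot>\<^bsub>H\<^esub> \<one>\<^bsub>H\<^esub> \<and>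
        tlift K H H H (\<lambda>h1 h2. h1 \<otimes>\<^bsub>H\<^esub> antipode H h2) (comult H h) = counit H h \<odot>\<^bsub>H\<^esub> \<one>\<^bsub>H\<^esub>)"

definition aug :: "('k, 'm) ring_scheme \<Rightarrow> ('k, 'h) hopf \<Rightarrow> 'h set"
  where "aug K H = {h \<in> carrier H. counit H h = \<zero>\<^bsub>K\<^esub>}"

abbreviation Hplus :: "('k, 'm) ring_scheme \<Rightarrow> ('k, 'h) hopf \<Rightarrow> ('k, 'h) hopf"
  where "Hplus K H \<equiv> H\<lparr>carrier := aug K H\<rparr>"

definition plus_part :: "('k, 'h) hopf \<Rightarrow> 'h \<Rightarrow> 'h"
  where "plus_part H h = h \<ominus>\<^bsub>H\<^esub> (counit H h \<odot>\<^bsub>H\<^esub> \<one>\<^bsub>H\<^esub>)"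

text \<open>\<open>Ad\<^sub>R(h) = h\<^sub>(\<^sub>2\<^sub>) \<otimes> S(h\<^sub>(\<^sub>1\<^sub>)) h\<^sub>(\<^sub>3\<^sub>)\<close>, where \<open>h\<^sub>(\<^sub>1\<^sub>) \<otimes> h\<^sub>(\<^sub>2\<^sub>) \<otimes> h\<^sub>(\<^sub>3\<^sub>)\<close> is obtained by applying
  the coproduct to the left leg of \<open>\<Delta>(h)\<close>.\<close>

definition AdR :: "('k, 'm) ring_scheme \<Rightarrow> ('k, 'h) hopf \<Rightarrow> 'h \<Rightarrow> ('k, 'h, 'h) tens"
  where "AdR K H h = tlift K H H (tensor K H H)
     (\<lambda>g h3. tlift K H H (tensor K H H)
        (\<lambda>h1 h2. pure K H H h2 (antipode H h1 \<otimes>\<^bsub>H\<^esub> h3)) (comult H g)) (comult H h)"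

definition Ad_invariant :: "('k, 'm) ring_scheme \<Rightarrow> ('k, 'h) hopf \<Rightarrow> 'h set \<Rightarrow> bool"
  where "Ad_invariant K H I \<longleftrightarrow> AdR K H ` I \<subseteq> tsub K H H I (carrier H)"

definition right_ideal :: "('k, 'h, 'p) module_scheme \<Rightarrow> 'h set \<Rightarrow> bool"
  where "right_ideal H I \<longleftrightarrow> additive_subgroup I H \<and> (\<forall>x \<in> I. \<forall>h \<in> carrier H. x \<otimes>\<^bsub>H\<^esub> h \<in> I)"


section \<open>Hopf--Galois extensions and principal comodule algebras\<close>

record ('k, 'h, 'a) comod_alg = "('k, 'a) module" +
  coact :: "'a \<Rightarrow> ('a \<times> 'h \<Rightarrow> 'k) set"

definition comodule_algebra ::
  "('k, 'm) ring_scheme \<Rightarrow> ('k, 'h) hopf \<Rightarrow> ('k, 'h, 'a) comod_alg \<Rightarrow> bool"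
  where "comodule_algebra K H A \<longleftrightarrow> k_algebra K A \<and>
     coact A \<in> lin K A (tensor K A H) \<and>
     (\<forall>a \<in> carrier A.
        tassoc K A H H (tmap K A H (tensor K A H) H (coact A) id (coact A a))
          = tmap K A H A (tensor K H H) id (comult H) (coact A a) \<and>
        tlift K A H A (\<lambda>x h. counit H h \<odot>\<^bsub>A\<^esub> x) (coact A a) = a) \<and>
     coact A \<one>\<^bsub>A\<^esub> = pure K A H \<one>\<^bsub>A\<^esub> \<one>\<^bsub>H\<^esub> \<and>
     (\<forall>a \<in> carrier A. \<forall>a' \<in> carrier A.
        coact A (a \<otimes>\<^bsub>A\<^esub> a') = tmult K A H (coact A a) (coact A a'))"

definition coinv :: "('k, 'm) ring_scheme \<Rightarrow> ('k, 'h) hopf \<Rightarrow> ('k, 'h, 'a) comod_alg \<Rightarrow> 'a set"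
  where "coinv K H A = {b \<in> carrier A. coact A b = pure K A H b \<one>\<^bsub>H\<^esub>}"

abbreviation AA :: "('k, 'm) ring_scheme \<Rightarrow> ('k, 'h, 'a) comod_alg \<Rightarrow> ('k, ('k, 'a, 'a) tens) module"
  where "AA K A \<equiv> tensor K A A"

definition balance :: "('k, 'm) ring_scheme \<Rightarrow> ('k, 'h) hopf \<Rightarrow> ('k, 'h, 'a) comod_alg
   \<Rightarrow> ('k, 'a, 'a) tens set"
  where "balance K H A = lspan K (AA K A)
     {pure K A A (a \<otimes>\<^bsub>A\<^esub> b) a' \<ominus>\<^bsub>AA K A\<^esub> pure K A A a (b \<otimes>\<^bsub>A\<^esub> a') | a b a'.
        a \<in> carrier A \<and> b \<in> coinv K H A \<and> a' \<in> carrier A}"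

definition AbA :: "('k, 'm) ring_scheme \<Rightarrow> ('k, 'h) hopf \<Rightarrow> ('k, 'h, 'a) comod_alg
   \<Rightarrow> ('k, ('k, 'a, 'a) tens set) module"
  where "AbA K H A = quot (AA K A) (balance K H A)"

definition proj :: "('k, 'm) ring_scheme \<Rightarrow> ('k, 'h) hopf \<Rightarrow> ('k, 'h, 'a) comod_alg
   \<Rightarrow> ('k, 'a, 'a) tens \<Rightarrow> ('k, 'a, 'a) tens set"
  where "proj K H A = qmap (AA K A) (balance K H A)"

definition mul :: "('k, 'm) ring_scheme \<Rightarrow> ('k, 'h, 'a) comod_alg \<Rightarrow> ('k, 'a, 'a) tens \<Rightarrow> 'a"
  where "mul K A = tlift K A A A (\<lambda>a a'. a \<otimes>\<^bsub>A\<^esub> a')"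

definition lact :: "('k, 'm) ring_scheme \<Rightarrow> ('k, 'h, 'a) comod_alg \<Rightarrow> 'a \<Rightarrow> ('k, 'a, 'a) tens \<Rightarrow> ('k, 'a, 'a) tens"
  where "lact K A c = tlift K A A (AA K A) (\<lambda>a a'. pure K A A (c \<otimes>\<^bsub>A\<^esub> a) a')"

definition ract :: "('k, 'm) ring_scheme \<Rightarrow> ('k, 'h, 'a) comod_alg \<Rightarrow> 'a \<Rightarrow> ('k, 'a, 'a) tens \<Rightarrow> ('k, 'a, 'a) tens"
  where "ract K A c = tlift K A A (AA K A) (\<lambda>a a'. pure K A A a (a' \<otimes>\<^bsub>A\<^esub> c))"

definition lactB :: "('k, 'm) ring_scheme \<Rightarrow> ('k, 'h) hopf \<Rightarrow> ('k, 'h, 'a) comod_alg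
   \<Rightarrow> 'a \<Rightarrow> ('k, 'a, 'a) tens set \<Rightarrow> ('k, 'a, 'a) tens set"
  where "lactB K H A c = qlift (AA K A) (balance K H A) (\<lambda>t. proj K H A (lact K A c t))"

definition can_tilde :: "('k, 'm) ring_scheme \<Rightarrow> ('k, 'h) hopf \<Rightarrow> ('k, 'h, 'a) comod_alg
   \<Rightarrow> ('k, 'a, 'a) tens \<Rightarrow> ('k, 'a, 'h) tens"
  where "can_tilde K H A = tlift K A A (tensor K A H)
     (\<lambda>a a'. tlift K A H (tensor K A H) (\<lambda>a0 a1. pure K A H (a \<otimes>\<^bsub>A\<^esub> a0) a1) (coact A a'))"

definition can :: "('k, 'm) ring_scheme \<Rightarrow> ('k, 'h) hopf \<Rightarrow> ('k, 'h, 'a) comod_alg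
   \<Rightarrow> ('k, 'a, 'a) tens set \<Rightarrow> ('k, 'a, 'h) tens"
  where "can K H A = qlift (AA K A) (balance K H A) (can_tilde K H A)"

definition hopf_galois :: "('k, 'm) ring_scheme \<Rightarrow> ('k, 'h) hopf \<Rightarrow> ('k, 'h, 'a) comod_alg \<Rightarrow> bool"
  where "hopf_galois K H A \<longleftrightarrow>
     bij_betw (can K H A) (carrier (AbA K H A)) (carrier (tensor K A H))"

definition translation :: "('k, 'm) ring_scheme \<Rightarrow> ('k, 'h) hopf \<Rightarrow> ('k, 'h, 'a) comod_alg
   \<Rightarrow> 'h \<Rightarrow> ('k, 'a, 'a) tens set"
  where "translation K H A h =
     inv_into (carrier (AbA K H A)) (can K H A) (pure K A H \<one>\<^bsub>A\<^esub> h)"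

text \<open>The splitting \<open>r\<close> of the multiplication \<open>B \<otimes> A \<rightarrow> A\<close> is left \<open>B\<close>-linear and right \<open>H\<close>-colinear,
  \<open>H\<close> coacting on the second tensor factor only.\<close>

definition principal_comodule_algebra :: "('k, 'm) ring_scheme \<Rightarrow> ('k, 'h) hopf \<Rightarrow> ('k, 'h, 'a) comod_alg \<Rightarrow> bool"
  where "principal_comodule_algebra K H A \<longleftrightarrow> comodule_algebra K H A \<and> hopf_galois K H A \<and>
     (let B = on_sub A (coinv K H A); BA = tensor K B A in
       \<exists>r \<in> lin K A BA.
         (\<forall>a \<in> carrier A. tlift K B A A (\<lambda>b a'. b \<otimes>\<^bsub>A\<^esub> a') (r a) = a) \<and>
         (\<forall>b \<in> carrier B. \<forall>a \<in> carrier A.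
            r (b \<otimes>\<^bsub>A\<^esub> a) = tlift K B A BA (\<lambda>b' a'. pure K B A (b \<otimes>\<^bsub>A\<^esub> b') a') (r a)) \<and>
         (\<forall>a \<in> carrier A.
            tlift K B A (tensor K BA H)
              (\<lambda>b a'. tlift K A H (tensor K BA H)
                 (\<lambda>a0 a1. pure K BA H (pure K B A b a0) a1) (coact A a')) (r a)
            = tmap K A H BA H r id (coact A a)))"


section \<open>Differential calculi\<close>

definition coactAA :: "('k, 'm) ring_scheme \<Rightarrow> ('k, 'h) hopf \<Rightarrow> ('k, 'h, 'a) comod_alg
   \<Rightarrow> ('k, 'a, 'a) tens \<Rightarrow> ('k, ('k, 'a, 'a) tens, 'h) tens"
  where "coactAA K H A = (let T = tensor K (AA K A) H in
     tlift K A A T (\<lambda>a a'.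
       tlift K A H T (\<lambda>a0 a1.
         tlift K A H T (\<lambda>a'0 a'1. pure K (AA K A) H (pure K A A a0 a'0) (a1 \<otimes>\<^bsub>H\<^esub> a'1))
           (coact A a')) (coact A a)))"

definition coactAbA :: "('k, 'm) ring_scheme \<Rightarrow> ('k, 'h) hopf \<Rightarrow> ('k, 'h, 'a) comod_alg
   \<Rightarrow> ('k, 'a, 'a) tens set \<Rightarrow> ('k, ('k, 'a, 'a) tens set, 'h) tens"
  where "coactAbA K H A = qlift (AA K A) (balance K H A)
     (\<lambda>t. tmap K (AA K A) H (AbA K H A) H (proj K H A) id (coactAA K H A t))"

definition Omega_u :: "('k, 'm) ring_scheme \<Rightarrow> ('k, 'h, 'a) comod_alg \<Rightarrow> ('k, 'a, 'a) tens set"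
  where "Omega_u K A = {t \<in> carrier (AA K A). mul K A t = \<zero>\<^bsub>A\<^esub>}"

text \<open>\<open>\<Omega>\<^sup>1\<^sub>u(B)\<close>, the kernel of the multiplication of \<open>B\<close>, inside \<open>A \<otimes> A\<close> via \<open>B \<otimes> B \<rightarrow> A \<otimes> A\<close>.\<close>

definition Omega_uB :: "('k, 'm) ring_scheme \<Rightarrow> ('k, 'h) hopf \<Rightarrow> ('k, 'h, 'a) comod_alg
   \<Rightarrow> ('k, 'a, 'a) tens set"
  where "Omega_uB K H A = (let B = on_sub A (coinv K H A) in
     tmap K B B A A id id ` Omega_u K B)"

definition ver_u :: "('k, 'm) ring_scheme \<Rightarrow> ('k, 'h) hopf \<Rightarrow> ('k, 'h, 'a) comod_alg
   \<Rightarrow> ('k, 'a, 'a) tens \<Rightarrow> ('k, 'a, 'h) tens"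
  where "ver_u K H A = (let T = tensor K A (Hplus K H) in
     tlift K A A T (\<lambda>a a'. tlift K A H T
       (\<lambda>a0 a1. pure K A (Hplus K H) (a \<otimes>\<^bsub>A\<^esub> a0) (plus_part H a1)) (coact A a')))"

text \<open>The Durdevic braiding \<open>a \<otimes> a' \<mapsto> a\<^sub>(\<^sub>0\<^sub>) a' \<tau>(a\<^sub>(\<^sub>1\<^sub>))\<close> on \<open>A \<otimes>\<^sub>B A\<close>.\<close>

definition braiding :: "('k, 'm) ring_scheme \<Rightarrow> ('k, 'h) hopf \<Rightarrow> ('k, 'h, 'a) comod_alg
   \<Rightarrow> ('k, 'a, 'a) tens set \<Rightarrow> ('k, 'a, 'a) tens set"
  where "braiding K H A = qlift (AA K A) (balance K H A)
     (tlift K A A (AbA K H A) (\<lambda>a a'. tlift K A H (AbA K H A)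
        (\<lambda>a0 a1. lactB K H A (a0 \<otimes>\<^bsub>A\<^esub> a') (translation K H A a1)) (coact A a)))"

definition sigma_stable :: "('k, 'm) ring_scheme \<Rightarrow> ('k, 'h) hopf \<Rightarrow> ('k, 'h, 'a) comod_alg
   \<Rightarrow> ('k, 'a, 'a) tens set set \<Rightarrow> bool"
  where "sigma_stable K H A V \<longleftrightarrow> submodule V K (AbA K H A) \<and> braiding K H A ` V = V"

definition sigma_hull :: "('k, 'm) ring_scheme \<Rightarrow> ('k, 'h) hopf \<Rightarrow> ('k, 'h, 'a) comod_alg
   \<Rightarrow> ('k, 'a, 'a) tens set set \<Rightarrow> ('k, 'a, 'a) tens set set"
  where "sigma_hull K H A W = \<Inter>{V. sigma_stable K H A V \<and> W \<subseteq> V}"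

text \<open>The subbimodule \<open>A \<cdot> X \<cdot> A\<close> of \<open>A \<otimes> A\<close> generated by \<open>X\<close>.\<close>

definition subbimod :: "('k, 'm) ring_scheme \<Rightarrow> ('k, 'h, 'a) comod_alg
   \<Rightarrow> ('k, 'a, 'a) tens set \<Rightarrow> ('k, 'a, 'a) tens set"
  where "subbimod K A X = \<Inter>{N. submodule N K (AA K A) \<and>
     (\<forall>c \<in> carrier A. \<forall>t \<in> N. lact K A c t \<in> N \<and> ract K A c t \<in> N) \<and> X \<subseteq> N}"

definition strong_connection :: "('k, 'm) ring_scheme \<Rightarrow> ('k, 'h) hopf \<Rightarrow> ('k, 'h, 'a) comod_alg
   \<Rightarrow> ('h \<Rightarrow> ('k, 'a, 'a) tens) \<Rightarrow> bool"
  where "strong_connection K H A l \<longleftrightarrow> l \<in> lin K H (AA K A) \<and>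
     l \<one>\<^bsub>H\<^esub> = pure K A A \<one>\<^bsub>A\<^esub> \<one>\<^bsub>A\<^esub> \<and>
     (\<forall>h \<in> carrier H.
        tlift K A A (tensor K (AA K A) H)
          (\<lambda>a a'. tlift K A H (tensor K (AA K A) H)
             (\<lambda>a0 a1. pure K (AA K A) H (pure K A A a a0) a1) (coact A a')) (l h)
        = tmap K H H (AA K A) H l id (comult H h)) \<and>
     (\<forall>h \<in> carrier H. can_tilde K H A (l h) = pure K A H \<one>\<^bsub>A\<^esub> h)"

text \<open>In the covariance condition \<open>Ad\<^sub>R(h)\<close> lies in \<open>H\<^sup>+ \<otimes> H\<close>, where \<open>x\<^sup>+ = x\<close> in the first leg, so that the
  right-hand side is \<open>(\<omega> \<otimes> id)(Ad\<^sub>R(h))\<close>; writing \<open>\<omega>(x\<^sup>+)\<close> makes it an expression on all of \<open>H \<otimes> H\<close>.\<close>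

definition connection_form :: "('k, 'm) ring_scheme \<Rightarrow> ('k, 'h) hopf \<Rightarrow> ('k, 'h, 'a) comod_alg
   \<Rightarrow> ('h \<Rightarrow> ('k, 'a, 'a) tens) \<Rightarrow> bool"
  where "connection_form K H A \<omega> \<longleftrightarrow>
     \<omega> \<in> lin K (Hplus K H) (on_sub (AA K A) (Omega_u K A)) \<and>
     (\<forall>h \<in> aug K H. ver_u K H A (\<omega> h) = pure K A (Hplus K H) \<one>\<^bsub>A\<^esub> h) \<and>
     (\<forall>h \<in> aug K H. coactAA K H A (\<omega> h)
        = tmap K H H (AA K A) H (\<lambda>x. \<omega> (plus_part H x)) id (AdR K H h))"

definition associated_form :: "('k, 'm) ring_scheme \<Rightarrow> ('k, 'h) hopf \<Rightarrow> ('k, 'h, 'a) comod_alg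
   \<Rightarrow> ('h \<Rightarrow> ('k, 'a, 'a) tens) \<Rightarrow> ('h \<Rightarrow> ('k, 'a, 'a) tens) \<Rightarrow> bool"
  where "associated_form K H A l \<omega> \<longleftrightarrow> strong_connection K H A l \<and> connection_form K H A \<omega> \<and>
     (\<forall>h \<in> carrier H. \<omega> (plus_part H h) =
        l h \<ominus>\<^bsub>AA K A\<^esub> (counit H h \<odot>\<^bsub>AA K A\<^esub> pure K A A \<one>\<^bsub>A\<^esub> \<one>\<^bsub>A\<^esub>))"

text \<open>The multiplication of \<open>A\<close> factors through \<open>\<pi> : A \<otimes> A \<rightarrow> A \<otimes>\<^sub>B A\<close>, hence \<open>\<pi>\<close> maps \<open>\<Omega>\<^sup>1\<^sub>u(A)\<close> onto the
  kernel of the multiplication \<open>A \<otimes>\<^sub>B A \<rightarrow> A\<close>, and no map with values in \<open>\<Omega>\<^sup>1\<^sub>u(A)\<close> splits \<open>\<pi>\<close> over all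
  of \<open>A \<otimes>\<^sub>B A\<close> unless \<open>A = 0\<close>. A splitting therefore takes values in \<open>A \<otimes> A\<close> here; where needed,
  values in \<open>\<Omega>\<^sup>1\<^sub>u(A)\<close> are demanded on the \<open>\<sigma>\<close>-stable subspace it is applied to.\<close>

definition colinear_splitting :: "('k, 'm) ring_scheme \<Rightarrow> ('k, 'h) hopf \<Rightarrow> ('k, 'h, 'a) comod_alg
   \<Rightarrow> (('k, 'a, 'a) tens set \<Rightarrow> ('k, 'a, 'a) tens) \<Rightarrow> bool"
  where "colinear_splitting K H A s \<longleftrightarrow> s \<in> lin K (AbA K H A) (AA K A) \<and>
     (\<forall>x \<in> carrier (AbA K H A). proj K H A (s x) = x) \<and>
     (\<forall>x \<in> carrier (AbA K H A).
        coactAA K H A (s x) = tmap K (AbA K H A) H (AA K A) H s id (coactAbA K H A x))"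

definition conn_hull :: "('k, 'm) ring_scheme \<Rightarrow> ('k, 'h) hopf \<Rightarrow> ('k, 'h, 'a) comod_alg
   \<Rightarrow> 'h set \<Rightarrow> ('h \<Rightarrow> ('k, 'a, 'a) tens) \<Rightarrow> ('k, 'a, 'a) tens set set"
  where "conn_hull K H A I \<omega> = sigma_hull K H A (proj K H A ` \<omega> ` I)"

definition N_A :: "('k, 'm) ring_scheme \<Rightarrow> ('k, 'h) hopf \<Rightarrow> ('k, 'h, 'a) comod_alg
   \<Rightarrow> 'h set \<Rightarrow> ('h \<Rightarrow> ('k, 'a, 'a) tens) \<Rightarrow> (('k, 'a, 'a) tens set \<Rightarrow> ('k, 'a, 'a) tens)
   \<Rightarrow> ('k, 'a, 'a) tens set"
  where "N_A K H A I \<omega> s = subbimod K A (s ` conn_hull K H A I \<omega>)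
     <+>\<^bsub>AA K A\<^esub> subbimod K A (Omega_uB K H A)"

end

theory Submission
  imports Defs
begin

text \<open>The elements of \<open>\<Omega>\<^sup>1\<^sub>u(A)\<close> that \<open>ver\<^sub>u\<close> sends into \<open>A \<otimes> I\<^sub>H\<close> form a subbimodule: \<open>ver\<^sub>u\<close> is left
  \<open>A\<close>-linear, and \<open>(gh)\<^sup>+ = g\<^sup>+ h + \<epsilon>(g) h\<^sup>+\<close> gives
  \<open>ver\<^sub>u(t c) = ver\<^sub>u(t) \<delta>(c) + m(t) c\<^sub>(\<^sub>0\<^sub>) \<otimes> (c\<^sub>(\<^sub>1\<^sub>))\<^sup>+\<close>, where the second term vanishes on
  \<open>\<Omega>\<^sup>1\<^sub>u(A) = ker m\<close> and the first stays in \<open>A \<otimes> I\<^sub>H\<close> because \<open>I\<^sub>H\<close> is a right ideal. The subbimodule contains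
  the image under \<open>s\<close> of the \<open>\<sigma>\<close>-stable hull by hypothesis, and \<open>\<Omega>\<^sup>1\<^sub>u(B)\<close> because \<open>1\<^sup>+ = 0\<close>; so it contains
  \<open>N\<^sub>A\<close>. Surjectivity follows from \<open>ver\<^sub>u(a \<omega>(h)) = a \<otimes> h\<close>.\<close>

section \<open>Linear maps and quotients\<close>

text \<open>An element of a tensor product is a coset of finitely supported functions, and a
  Sweedler expression is a nest of \<open>tlift\<close>s, each of which has its intended meaning
  only once its integrand is known to be bilinear. That obligation, more than the computation,
  shapes the proof. The inner lift becomes a function of an arbitrary element of the inner tensor
  product, is shown to be linear in the outer variables too (\<open>tlift_param_lin\<close>), and
  the resulting linear maps are compared on pure tensors (\<open>tensor_lin_eqI\<close>). A value
  such as \<open>coact A c\<close> is in general not pure, so a formula involving it is proved for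
  every element of \<open>A \<otimes> H\<close> and specialised afterwards. A second obstacle is
  that \<open>A \<otimes> H\<^sup>+\<close> is not a subset of \<open>A \<otimes> H\<close>: the two
  are quotients of different free modules by different relations. The product
  \<open>ver\<^sub>u(t) \<delta>(c)\<close> is therefore not an instance of the product
  \<open>tmult\<close> of \<open>A \<otimes> H\<close>, but of a separate action
  \<open>ractP\<close> of \<open>A \<otimes> H\<close> on \<open>A \<otimes> H\<^sup>+\<close>. For
  the same reason \<open>B \<otimes> B\<close> reaches \<open>A \<otimes> A\<close> only through an
  explicit map.\<close>

lemma submodule_iff:
  assumes "module K V"
  shows "submodule U K V \<longleftrightarrow> U \<subseteq> carrier V \<and> \<zero>\<^bsub>V\<^esub> \<in> U \<and>
    (\<forall>x \<in> U. \<forall>y \<in> U. x \<oplus>\<^bsub>V\<^esub> y \<in> U) \<and> (\<forall>c \<in> carrier K. \<forall>x \<in> U. c \<odot>\<^bsub>V\<^esub> x \<in> U)"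
    (is "_ \<longleftrightarrow> ?R")
proof
  interpret V: module K V by fact
  show "submodule U K V \<Longrightarrow> ?R"
    using V.submoduleE[of U] subgroup.one_closed[OF submodule.axioms(1), of U K V] by auto
  assume R: ?R
  show "submodule U K V"
  proof (rule V.submoduleI)
    fix x assume x: "x \<in> U"
    \<comment> \<open>Negation is multiplication by the scalar -1, so closure under it follows from
      closure under scalars.\<close>
    then have "\<ominus>\<^bsub>V\<^esub> x = (\<ominus>\<^bsub>K\<^esub> \<one>\<^bsub>K\<^esub>) \<odot>\<^bsub>V\<^esub> x"
      using R by (subst V.smult_l_minus) auto
    then show "\<ominus>\<^bsub>V\<^esub> x \<in> U" using R x by simp
  qed (use R in auto)
qed

lemma lin_closed: "f \<in> lin K V W \<Longrightarrow> x \<in> carrier V \<Longrightarrow> f x \<in> carrier W"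
  and lin_add: "f \<in> lin K V W \<Longrightarrow> x \<in> carrier V \<Longrightarrow> y \<in> carrier V \<Longrightarrow> f (x \<oplus>\<^bsub>V\<^esub> y) = f x \<oplus>\<^bsub>W\<^esub> f y"
  and lin_smult: "f \<in> lin K V W \<Longrightarrow> c \<in> carrier K \<Longrightarrow> x \<in> carrier V \<Longrightarrow> f (c \<odot>\<^bsub>V\<^esub> x) = c \<odot>\<^bsub>W\<^esub> f x"
  by (auto simp: lin_def)

lemma linI:
  assumes "\<And>x. x \<in> carrier V \<Longrightarrow> f x \<in> carrier W"
    and "\<And>x y. x \<in> carrier V \<Longrightarrow> y \<in> carrier V \<Longrightarrow> f (x \<oplus>\<^bsub>V\<^esub> y) = f x \<oplus>\<^bsub>W\<^esub> f y"
    and "\<And>c x. c \<in> carrier K \<Longrightarrow> x \<in> carrier V \<Longrightarrow> f (c \<odot>\<^bsub>V\<^esub> x) = c \<odot>\<^bsub>W\<^esub> f x"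
  shows "f \<in> lin K V W"
  using assms by (auto simp: lin_def)

text \<open>\<open>lin\<close> sees a function only on the carrier, so a formula valid there may
  stand in for the defining one.\<close>

lemma lin_cong:
  assumes "module K V" "f \<in> lin K V W" "\<And>x. x \<in> carrier V \<Longrightarrow> g x = f x"
  shows "g \<in> lin K V W"
proof -
  interpret V: module K V by fact
  show ?thesis
    using assms(2) by (intro linI) (simp_all add: assms(3) lin_closed lin_add lin_smult)
qed

lemma lin_comp: "f \<in> lin K V W \<Longrightarrow> g \<in> lin K W U \<Longrightarrow> (\<lambda>x. g (f x)) \<in> lin K V U"
  by (intro linI) (simp_all add: lin_closed[of f K V W] lin_closed[of g K W U] lin_add[of f K V W]
      lin_add[of g K W U] lin_smult[of f K V W] lin_smult[of g K W U])

lemma lin_zero: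
  assumes "module K V" "module K W" "f \<in> lin K V W"
  shows "f \<zero>\<^bsub>V\<^esub> = \<zero>\<^bsub>W\<^esub>"
proof -
  interpret V: module K V by fact
  interpret W: module K W by fact
  have "f (\<zero>\<^bsub>K\<^esub> \<odot>\<^bsub>V\<^esub> \<zero>\<^bsub>V\<^esub>) = \<zero>\<^bsub>K\<^esub> \<odot>\<^bsub>W\<^esub> f \<zero>\<^bsub>V\<^esub>"
    by (rule lin_smult[OF assms(3)]) auto
  then show ?thesis using lin_closed[OF assms(3)] by simp
qed

lemma lin_minus:
  assumes "module K V" "module K W" "f \<in> lin K V W" "x \<in> carrier V" "y \<in> carrier V"
  shows "f (x \<ominus>\<^bsub>V\<^esub> y) = f x \<ominus>\<^bsub>W\<^esub> f y"
proof -
  interpret V: module K V by fact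
  interpret W: module K W by fact
  have "f (\<ominus>\<^bsub>V\<^esub> y) = f ((\<ominus>\<^bsub>K\<^esub> \<one>\<^bsub>K\<^esub>) \<odot>\<^bsub>V\<^esub> y)"
    using assms by (subst V.smult_l_minus) auto
  also have "\<dots> = \<ominus>\<^bsub>W\<^esub> f y"
    using assms lin_closed[OF assms(3)] by (subst lin_smult[OF assms(3)]) (auto simp: W.smult_l_minus)
  finally show ?thesis
    using assms by (simp add: a_minus_def lin_add[OF assms(3)])
qed

lemma lin_plus:
  assumes "module K W" "f \<in> lin K V W" "g \<in> lin K V W"
  shows "(\<lambda>x. f x \<oplus>\<^bsub>W\<^esub> g x) \<in> lin K V W"
proof -
  interpret W: module K W by fact
  show ?thesis
    using assms(2,3)
    by (intro linI) (auto simp: lin_closed lin_add lin_smult W.a_ac W.smult_r_distr)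
qed

section \<open>Submodules from preimages, equalizers, images, intersections and sums\<close>

lemma submodule_vimage:
  assumes "module K V" "module K W" "f \<in> lin K V W" "submodule U K W"
  shows "submodule {x \<in> carrier V. f x \<in> U} K V"
proof -
  interpret V: module K V by fact
  show ?thesis
    using assms lin_zero[OF assms(1-3)] lin_add[OF assms(3)] lin_smult[OF assms(3)]
    by (auto simp: submodule_iff)
qed

lemma submodule_equalizer:
  assumes "module K V" "module K W" "f \<in> lin K V W" "g \<in> lin K V W"
  shows "submodule {x \<in> carrier V. f x = g x} K V"
proof -
  interpret V: module K V by fact
  show ?thesis
    using assms lin_zero[OF assms(1,2,3)] lin_zero[OF assms(1,2,4)]
    by (auto simp: submodule_iff lin_add[OF assms(3)] lin_add[OF assms(4)]
        lin_smult[OF assms(3)] lin_smult[OF assms(4)])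
qed

lemma submodule_zero:
  assumes "module K V"
  shows "submodule {\<zero>\<^bsub>V\<^esub>} K V"
proof -
  interpret V: module K V by fact
  show ?thesis by (auto simp: submodule_iff[OF assms])
qed

lemma submodule_kernel:
  assumes "module K V" "module K W" "f \<in> lin K V W"
  shows "submodule {x \<in> carrier V. f x = \<zero>\<^bsub>W\<^esub>} K V"
  using submodule_vimage[OF assms submodule_zero[OF assms(2)]] by simp

text \<open>This serves surjectivity onto a tensor product: an image that is a submodule has only to
  contain the pure tensors.\<close>

lemma submodule_image:
  assumes "module K V" "module K W" "f \<in> lin K V W"
  shows "submodule (f ` carrier V) K W"
proof -
  interpret V: module K V by fact
  have "f x \<oplus>\<^bsub>W\<^esub> f y \<in> f ` carrier V" if "x \<in> carrier V" "y \<in> carrier V" for x y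
    using that by (simp flip: lin_add[OF assms(3)])
  moreover have "c \<odot>\<^bsub>W\<^esub> f x \<in> f ` carrier V" if "c \<in> carrier K" "x \<in> carrier V" for c x
    using that by (simp flip: lin_smult[OF assms(3)])
  moreover have "\<zero>\<^bsub>W\<^esub> \<in> f ` carrier V"
    using lin_zero[OF assms] by (metis V.zero_closed imageI)
  ultimately show ?thesis
    using lin_closed[OF assms(3)] by (auto simp: submodule_iff[OF assms(2)])
qed

lemma submodule_Inter:
  assumes "module K V" "\<And>U. U \<in> \<C> \<Longrightarrow> submodule U K V" "\<C> \<noteq> {}"
  shows "submodule (\<Inter>\<C>) K V"
proof -
  have U: "U \<subseteq> carrier V \<and> \<zero>\<^bsub>V\<^esub> \<in> U \<and> (\<forall>x \<in> U. \<forall>y \<in> U. x \<oplus>\<^bsub>V\<^esub> y \<in> U) \<and>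
      (\<forall>c \<in> carrier K. \<forall>x \<in> U. c \<odot>\<^bsub>V\<^esub> x \<in> U)" if "U \<in> \<C>" for U
    using assms(2)[OF that] by (simp add: submodule_iff[OF assms(1)])
  obtain U where "U \<in> \<C>" using assms(3) by auto
  then have "\<Inter>\<C> \<subseteq> carrier V" using U by blast
  then show ?thesis
    unfolding submodule_iff[OF assms(1)] using U by (intro conjI ballI InterI) simp_all
qed

lemma submodule_set_add:
  assumes "module K V" "submodule U K V" "submodule U' K V"
  shows "submodule (U <+>\<^bsub>V\<^esub> U') K V"
proof -
  interpret V: module K V by fact
  have sub: "U \<subseteq> carrier V" "U' \<subseteq> carrier V"
    using assms by (auto simp: submodule_iff)
  have "\<zero>\<^bsub>V\<^esub> \<in> U <+>\<^bsub>V\<^esub> U'"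
    using assms by (auto simp: submodule_iff set_add_def' intro!: bexI[of _ "\<zero>\<^bsub>V\<^esub>"])
  moreover have "x \<oplus>\<^bsub>V\<^esub> y \<in> U <+>\<^bsub>V\<^esub> U'" if xy: "x \<in> U <+>\<^bsub>V\<^esub> U'" "y \<in> U <+>\<^bsub>V\<^esub> U'" for x y
  proof -
    obtain a b a' b' where *: "x = a \<oplus>\<^bsub>V\<^esub> b" "y = a' \<oplus>\<^bsub>V\<^esub> b'" "a \<in> U" "b \<in> U'" "a' \<in> U" "b' \<in> U'"
      using xy by (auto simp: set_add_def')
    then have "x \<oplus>\<^bsub>V\<^esub> y = (a \<oplus>\<^bsub>V\<^esub> a') \<oplus>\<^bsub>V\<^esub> (b \<oplus>\<^bsub>V\<^esub> b')"
      using sub by (auto simp: V.a_ac subset_iff)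
    moreover have "a \<oplus>\<^bsub>V\<^esub> a' \<in> U" "b \<oplus>\<^bsub>V\<^esub> b' \<in> U'"
      using * assms by (auto simp: submodule_iff)
    ultimately show ?thesis by (auto simp: set_add_def')
  qed
  moreover have "c \<odot>\<^bsub>V\<^esub> x \<in> U <+>\<^bsub>V\<^esub> U'" if cx: "c \<in> carrier K" "x \<in> U <+>\<^bsub>V\<^esub> U'" for c x
  proof -
    obtain a b where *: "x = a \<oplus>\<^bsub>V\<^esub> b" "a \<in> U" "b \<in> U'"
      using cx by (auto simp: set_add_def')
    then have "c \<odot>\<^bsub>V\<^esub> x = c \<odot>\<^bsub>V\<^esub> a \<oplus>\<^bsub>V\<^esub> c \<odot>\<^bsub>V\<^esub> b"
      using sub cx by (auto simp: V.smult_r_distr subset_iff)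
    moreover have "c \<odot>\<^bsub>V\<^esub> a \<in> U" "c \<odot>\<^bsub>V\<^esub> b \<in> U'"
      using * assms cx by (auto simp: submodule_iff)
    ultimately show ?thesis by (auto simp: set_add_def')
  qed
  ultimately show ?thesis
    using V.set_add_closed[OF sub] by (auto simp: submodule_iff[OF assms(1)])
qed

lemma module_on_sub: "module K V \<Longrightarrow> submodule U K V \<Longrightarrow> module K (on_sub V U)"
  by (rule submodule.submodule_is_module)

lemma lin_on_sub: "submodule U K V \<Longrightarrow> module K V \<Longrightarrow> f \<in> lin K V W \<Longrightarrow> f \<in> lin K (on_sub V U) W"
  by (intro linI) (auto simp: submodule_iff subset_iff lin_closed[of f K V W] lin_add[of f K V W]
      lin_smult[of f K V W])

lemma lspan_submodule:
  assumes "module K V" "X \<subseteq> carrier V"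
  shows "submodule (lspan K V X) K V"
proof -
  have "carrier V \<in> {U. submodule U K V \<and> X \<subseteq> U}"
    using module.carrier_is_submodule[OF assms(1)] assms(2) by auto
  then show ?thesis unfolding lspan_def by (intro submodule_Inter[OF assms(1)]) blast+
qed

lemma lspan_superset: "X \<subseteq> lspan K V X"
  by (auto simp: lspan_def)

lemma lspan_least: "submodule U K V \<Longrightarrow> X \<subseteq> U \<Longrightarrow> lspan K V X \<subseteq> U"
  by (auto simp: lspan_def)

section \<open>Quotient modules and induced maps\<close>

lemma submodule_abelian_subgroup:
  assumes "module K V" "submodule U K V"
  shows "abelian_subgroup U V"
  using assms by (intro abelian_subgroupI3)
    (auto simp: submodule_def module_def intro: additive_subgroupI)

context
  fixes K :: "('k, 'm) ring_scheme" and V :: "('k, 'v, 'p) module_scheme" and U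
  assumes V: "module K V" and U: "submodule U K V"
begin

interpretation V: module K V by (rule V)
interpretation U: abelian_subgroup U V by (rule submodule_abelian_subgroup[OF V U])

lemma quot_sel: "carrier (quot V U) = qmap V U ` carrier V" "\<zero>\<^bsub>quot V U\<^esub> = U"
    "add (quot V U) = set_add V"
  by (auto simp: quot_def A_RCOSETS_def' qmap_def)

lemma qmap_eq_iff:
  assumes "x \<in> carrier V" "y \<in> carrier V"
  shows "qmap V U x = qmap V U y \<longleftrightarrow> x \<ominus>\<^bsub>V\<^esub> y \<in> U"
proof
  assume "qmap V U x = qmap V U y"
  then have "x \<in> U +>\<^bsub>V\<^esub> y" using U.a_rcos_self[OF assms(1)] by (simp add: qmap_def)
  then show "x \<ominus>\<^bsub>V\<^esub> y \<in> U" using U.a_rcos_module_minus[of y x] assms V.ring_axioms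
    by (simp add: U.a_rcos_module a_minus_def)
next
  assume "x \<ominus>\<^bsub>V\<^esub> y \<in> U"
  then have "x \<in> U +>\<^bsub>V\<^esub> y" using assms by (simp add: U.a_rcos_module a_minus_def)
  then show "qmap V U x = qmap V U y"
    using U.a_repr_independence'[of x y] assms by (simp add: qmap_def)
qed

lemma qmap_add:
  assumes "x \<in> carrier V" "y \<in> carrier V"
  shows "qmap V U (x \<oplus>\<^bsub>V\<^esub> y) = qmap V U x \<oplus>\<^bsub>quot V U\<^esub> qmap V U y"
  using U.a_rcos_sum[OF assms] by (simp add: qmap_def quot_sel)

text \<open>The scalar action on cosets adds \<open>U\<close> back because the pointwise multiple of
  a coset can be too small: for scalar zero it is just the zero vector. The representative
  \<open>x\<close> of its own coset gives one inclusion; in the other, the summand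
  \<open>u \<oplus> c v\<close> is absorbed by \<open>U\<close>.\<close>

lemma qmap_smult:
  assumes "c \<in> carrier K" "x \<in> carrier V"
  shows "qmap V U (c \<odot>\<^bsub>V\<^esub> x) = c \<odot>\<^bsub>quot V U\<^esub> qmap V U x"
proof -
  have sub: "\<And>u. u \<in> U \<Longrightarrow> u \<in> carrier V" using U.a_subset by auto
  have "U +>\<^bsub>V\<^esub> (c \<odot>\<^bsub>V\<^esub> x) = U <+>\<^bsub>V\<^esub> ((\<lambda>x. c \<odot>\<^bsub>V\<^esub> x) ` (U +>\<^bsub>V\<^esub> x))"
  proof (intro equalityI subsetI)
    fix z assume "z \<in> U +>\<^bsub>V\<^esub> (c \<odot>\<^bsub>V\<^esub> x)"
    then obtain u where "u \<in> U" "z = u \<oplus>\<^bsub>V\<^esub> c \<odot>\<^bsub>V\<^esub> x" by (auto simp: a_r_coset_def')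
    moreover have "x \<in> U +>\<^bsub>V\<^esub> x" by (rule U.a_rcos_self) fact
    ultimately show "z \<in> U <+>\<^bsub>V\<^esub> ((\<lambda>x. c \<odot>\<^bsub>V\<^esub> x) ` (U +>\<^bsub>V\<^esub> x))"
      by (auto simp: set_add_def')
  next
    fix z assume "z \<in> U <+>\<^bsub>V\<^esub> ((\<lambda>x. c \<odot>\<^bsub>V\<^esub> x) ` (U +>\<^bsub>V\<^esub> x))"
    then obtain u v where uv: "u \<in> U" "v \<in> U" "z = u \<oplus>\<^bsub>V\<^esub> c \<odot>\<^bsub>V\<^esub> (v \<oplus>\<^bsub>V\<^esub> x)"
      by (auto simp: set_add_def' a_r_coset_def')
    have "z = (u \<oplus>\<^bsub>V\<^esub> c \<odot>\<^bsub>V\<^esub> v) \<oplus>\<^bsub>V\<^esub> c \<odot>\<^bsub>V\<^esub> x"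
      using uv assms by (simp add: sub V.smult_r_distr V.a_assoc)
    moreover have "u \<oplus>\<^bsub>V\<^esub> c \<odot>\<^bsub>V\<^esub> v \<in> U"
      using uv U assms by (auto simp: submodule_iff[OF V])
    ultimately show "z \<in> U +>\<^bsub>V\<^esub> (c \<odot>\<^bsub>V\<^esub> x)" by (auto simp: a_r_coset_def')
  qed
  then show ?thesis by (simp add: quot_def qmap_def)
qed

lemma qmap_zero: "qmap V U \<zero>\<^bsub>V\<^esub> = U"
  using V.a_coset_add_zero[OF U.a_subset] by (simp add: qmap_def)

lemma qmap_eq_zero: "x \<in> U \<Longrightarrow> qmap V U x = \<zero>\<^bsub>quot V U\<^esub>"
  using U.a_rcos_const by (simp add: qmap_def quot_sel(2))

lemma qmap_lin: "qmap V U \<in> lin K V (quot V U)"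
  by (intro linI) (auto simp: qmap_add qmap_smult quot_sel)

lemma quot_module: "module K (quot V U)"
proof (rule moduleI)
  show "cring K" by unfold_locales
  note q = qmap_add[symmetric] qmap_smult[symmetric] quot_sel(1)
  show "abelian_group (quot V U)"
  proof (rule abelian_groupI)
    fix x assume "x \<in> carrier (quot V U)"
    then obtain v where v: "x = qmap V U v" "v \<in> carrier V" by (auto simp: q)
    then have "qmap V U (\<ominus>\<^bsub>V\<^esub> v) \<oplus>\<^bsub>quot V U\<^esub> x = \<zero>\<^bsub>quot V U\<^esub>"
      by (simp add: qmap_add[symmetric] V.l_neg qmap_zero quot_sel(2))
    then show "\<exists>y\<in>carrier (quot V U). y \<oplus>\<^bsub>quot V U\<^esub> x = \<zero>\<^bsub>quot V U\<^esub>"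
      using v by (auto simp: q)
    have "\<zero>\<^bsub>quot V U\<^esub> = qmap V U \<zero>\<^bsub>V\<^esub>" by (simp add: quot_sel qmap_zero)
    then show "\<zero>\<^bsub>quot V U\<^esub> \<oplus>\<^bsub>quot V U\<^esub> x = x"
      using v by (simp add: qmap_add[symmetric] del: quot_sel)
  next
    show "\<zero>\<^bsub>quot V U\<^esub> \<in> carrier (quot V U)"
      by (metis V.zero_closed imageI qmap_zero quot_sel(1,2))
  qed (auto simp: q V.a_ac)
qed (auto simp: qmap_add[symmetric] qmap_smult[symmetric] quot_sel(1)
    V.smult_l_distr V.smult_r_distr V.smult_assoc1)

context
  fixes W :: "('k, 'w, 'q) module_scheme" and f
  assumes W: "module K W" and f: "f \<in> lin K V W" and fU: "\<And>u. u \<in> U \<Longrightarrow> f u = \<zero>\<^bsub>W\<^esub>"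
begin

interpretation W: module K W by (rule W)

text \<open>A linear map that kills \<open>U\<close> is constant on each coset, so the image of a
  coset is a singleton and \<open>the_elem\<close> picks out its member.\<close>

lemma qlift_qmap:
  assumes x: "x \<in> carrier V"
  shows "qlift V U f (qmap V U x) = f x"
proof -
  have "f ` qmap V U x = {f x}"
  proof -
    have "f y = f x" if y: "y \<in> U +>\<^bsub>V\<^esub> x" for y
    proof -
      obtain u where u: "u \<in> U" "y = u \<oplus>\<^bsub>V\<^esub> x" using y by (auto simp: a_r_coset_def')
      then show ?thesis
        using x fU[of u] U.a_subset by (auto simp: lin_add[OF f] lin_closed[OF f])
    qed
    then show ?thesis
      unfolding qmap_def image_def using U.a_rcos_self[OF x] by blast
  qed
  then show ?thesis using x by (simp add: qlift_def quot_sel)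
qed

lemma qlift_lin: "qlift V U f \<in> lin K (quot V U) W"
  by (intro linI)
    (auto simp: quot_sel(1) qlift_qmap lin_closed[OF f] lin_add[OF f] lin_smult[OF f]
      qmap_add[symmetric] qmap_smult[symmetric])

end

end

section \<open>Tensor products\<close>

lemma free_mod_sel:
  "carrier (free_mod K X) = {f. (\<forall>x \<in> X. f x \<in> carrier K) \<and> (\<forall>x. x \<notin> X \<longrightarrow> f x = \<zero>\<^bsub>K\<^esub>) \<and> finite {x. f x \<noteq> \<zero>\<^bsub>K\<^esub>}}"
  "\<zero>\<^bsub>free_mod K X\<^esub> = (\<lambda>_. \<zero>\<^bsub>K\<^esub>)"
  "f \<oplus>\<^bsub>free_mod K X\<^esub> g = (\<lambda>x. f x \<oplus>\<^bsub>K\<^esub> g x)"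
  "c \<odot>\<^bsub>free_mod K X\<^esub> f = (\<lambda>x. c \<otimes>\<^bsub>K\<^esub> f x)"
  by (simp_all add: free_mod_def)

lemma free_mod_apply_closed:
  assumes "cring K" "f \<in> carrier (free_mod K X)"
  shows "f x \<in> carrier K"
proof -
  interpret cring K by fact
  show ?thesis using assms(2) by (cases "x \<in> X") (auto simp: free_mod_sel)
qed

lemma free_mod_module:
  assumes "cring K"
  shows "module K (free_mod K X)"
proof -
  interpret cring K by fact
  note cl = free_mod_apply_closed[OF assms]
  have add: "f \<oplus>\<^bsub>free_mod K X\<^esub> g \<in> carrier (free_mod K X)"
    if "f \<in> carrier (free_mod K X)" "g \<in> carrier (free_mod K X)" for f g
  proof -
    have "{x. f x \<oplus>\<^bsub>K\<^esub> g x \<noteq> \<zero>\<^bsub>K\<^esub>} \<subseteq> {x. f x \<noteq> \<zero>\<^bsub>K\<^esub>} \<union> {x. g x \<noteq> \<zero>\<^bsub>K\<^esub>}" by auto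
    then have "finite {x. f x \<oplus>\<^bsub>K\<^esub> g x \<noteq> \<zero>\<^bsub>K\<^esub>}"
      using that by (auto simp: free_mod_sel intro: finite_subset)
    then show ?thesis using that by (auto simp: free_mod_sel)
  qed
  have smult: "c \<odot>\<^bsub>free_mod K X\<^esub> f \<in> carrier (free_mod K X)"
    if "c \<in> carrier K" "f \<in> carrier (free_mod K X)" for f c
  proof -
    have "{x. c \<otimes>\<^bsub>K\<^esub> f x \<noteq> \<zero>\<^bsub>K\<^esub>} \<subseteq> {x. f x \<noteq> \<zero>\<^bsub>K\<^esub>}" using that by auto
    then have "finite {x. c \<otimes>\<^bsub>K\<^esub> f x \<noteq> \<zero>\<^bsub>K\<^esub>}"
      using that by (auto simp: free_mod_sel intro: finite_subset)
    then show ?thesis using that by (auto simp: free_mod_sel)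
  qed
  show ?thesis
  proof (rule moduleI)
    show "abelian_group (free_mod K X)"
    proof (rule abelian_groupI)
      fix f assume f: "f \<in> carrier (free_mod K X)"
      show "\<exists>g\<in>carrier (free_mod K X). g \<oplus>\<^bsub>free_mod K X\<^esub> f = \<zero>\<^bsub>free_mod K X\<^esub>"
        using smult[of "\<ominus>\<^bsub>K\<^esub> \<one>\<^bsub>K\<^esub>" f] f
        by (intro bexI[of _ "(\<ominus>\<^bsub>K\<^esub> \<one>\<^bsub>K\<^esub>) \<odot>\<^bsub>free_mod K X\<^esub> f"])
          (auto simp: free_mod_sel(2-) cl l_minus l_neg)
    next
      show "\<zero>\<^bsub>free_mod K X\<^esub> \<in> carrier (free_mod K X)" by (simp add: free_mod_sel)
    qed (fact add, simp_all add: free_mod_sel(2-) cl fun_eq_iff a_ac)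
    show "c \<odot>\<^bsub>free_mod K X\<^esub> f \<in> carrier (free_mod K X)"
      if "c \<in> carrier K" "f \<in> carrier (free_mod K X)" for c f
      using that by (rule smult)
  qed (simp_all add: assms free_mod_sel(2-) cl fun_eq_iff l_distr r_distr m_assoc)
qed

lemma free_gen_closed:
  assumes "cring K" "x \<in> X"
  shows "free_gen K x \<in> carrier (free_mod K X)"
proof -
  interpret cring K by fact
  have "{y. free_gen K x y \<noteq> \<zero>\<^bsub>K\<^esub>} \<subseteq> {x}" by (auto simp: free_gen_def)
  then have "finite {y. free_gen K x y \<noteq> \<zero>\<^bsub>K\<^esub>}" by (rule finite_subset) simp
  then show ?thesis using assms by (auto simp: free_mod_sel free_gen_def)
qed

lemma free_mod_spanned:
  assumes "cring K" "submodule U K (free_mod K X)" "\<And>x. x \<in> X \<Longrightarrow> free_gen K x \<in> U"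
    and "f \<in> carrier (free_mod K X)"
  shows "f \<in> U"
proof -
  interpret cring K by fact
  note U = assms(2)[unfolded submodule_iff[OF free_mod_module[OF assms(1)]]]
  have "finite {x. f x \<noteq> \<zero>\<^bsub>K\<^esub>}" using assms(4) by (simp add: free_mod_sel)
  then show ?thesis using assms(4)
  proof (induction "{x. f x \<noteq> \<zero>\<^bsub>K\<^esub>}" arbitrary: f rule: finite_induct)
    case empty
    then have "f = \<zero>\<^bsub>free_mod K X\<^esub>" by (auto simp: free_mod_sel)
    then show ?case using U by simp
  next
    case (insert a S)
    have a: "f a \<noteq> \<zero>\<^bsub>K\<^esub>" using insert by auto
    then have aX: "a \<in> X" using insert by (auto simp: free_mod_sel)
    note cl = free_mod_apply_closed[OF assms(1) insert.prems]
    \<comment> \<open>Erasing the value at \<open>a\<close> leaves a function with support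
      \<open>S\<close>, to which the induction hypothesis applies; what was erased is a multiple of
      one generator.\<close>
    let ?g = "f(a := \<zero>\<^bsub>K\<^esub>)"
    have S: "S = {x. ?g x \<noteq> \<zero>\<^bsub>K\<^esub>}" using insert.hyps by auto
    have "?g \<in> carrier (free_mod K X)"
      using insert.prems S insert.hyps(1) by (auto simp: free_mod_sel)
    then have g: "?g \<in> U" by (rule insert.hyps(3)[OF S])
    have "f = ?g \<oplus>\<^bsub>free_mod K X\<^esub> (f a \<odot>\<^bsub>free_mod K X\<^esub> free_gen K a)"
      using cl by (auto simp: free_mod_sel free_gen_def)
    moreover have "f a \<odot>\<^bsub>free_mod K X\<^esub> free_gen K a \<in> U"
      using U cl assms(3)[OF aX] by auto
    ultimately show ?case using U g by metis
  qed
qed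

definition free_lift ::
  "('k, 'm) ring_scheme \<Rightarrow> ('k, 'u, 'r) module_scheme \<Rightarrow> ('x \<Rightarrow> 'u) \<Rightarrow> ('x \<Rightarrow> 'k) \<Rightarrow> 'u"
  where "free_lift K U \<beta> f = (\<Oplus>\<^bsub>U\<^esub>p \<in> {p. f p \<noteq> \<zero>\<^bsub>K\<^esub>}. f p \<odot>\<^bsub>U\<^esub> \<beta> p)"

text \<open>The sum in \<open>free_lift\<close> runs over the support of \<open>f\<close>, which
  changes under addition and scaling. Summing over a common finite superset \<open>S\<close> makes
  such sums comparable; the extra terms have coefficient zero.\<close>

lemma free_lift_superset:
  assumes "module K U" "\<beta> \<in> X \<rightarrow> carrier U" "f \<in> carrier (free_mod K X)"
    and "finite S" "S \<subseteq> X" "{p. f p \<noteq> \<zero>\<^bsub>K\<^esub>} \<subseteq> S"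
  shows "free_lift K U \<beta> f = (\<Oplus>\<^bsub>U\<^esub>p \<in> S. f p \<odot>\<^bsub>U\<^esub> \<beta> p)"
proof -
  interpret U: module K U by fact
  show ?thesis
    unfolding free_lift_def
    using assms free_mod_apply_closed[OF U.is_cring assms(3)]
    by (intro U.add.finprod_mono_neutral_cong_left) (auto simp: Pi_iff subset_iff)
qed

lemma free_lift_lin:
  assumes "module K U" "\<beta> \<in> X \<rightarrow> carrier U"
  shows "free_lift K U \<beta> \<in> lin K (free_mod K X) U"
proof -
  interpret U: module K U by fact
  interpret F: module K "free_mod K X" by (rule free_mod_module) unfold_locales
  note cl = free_mod_apply_closed[OF U.is_cring]
  have supp: "finite {p. f p \<noteq> \<zero>\<^bsub>K\<^esub>}" "{p. f p \<noteq> \<zero>\<^bsub>K\<^esub>} \<subseteq> X" if "f \<in> carrier (free_mod K X)" for f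
    using that by (auto simp: free_mod_sel)
  have \<beta>: "\<beta> p \<in> carrier U" if "p \<in> X" for p using assms(2) that by auto
  show ?thesis
  proof (rule linI)
    fix f assume "f \<in> carrier (free_mod K X)"
    then show "free_lift K U \<beta> f \<in> carrier U"
      unfolding free_lift_def using supp[of f] cl[of f] \<beta> by (intro U.finsum_closed) auto
  next
    fix f g assume fg: "f \<in> carrier (free_mod K X)" "g \<in> carrier (free_mod K X)"
    define S where "S = {p. f p \<noteq> \<zero>\<^bsub>K\<^esub>} \<union> {p. g p \<noteq> \<zero>\<^bsub>K\<^esub>}"
    have S: "finite S" "S \<subseteq> X" and fS: "{p. f p \<noteq> \<zero>\<^bsub>K\<^esub>} \<subseteq> S" and gS: "{p. g p \<noteq> \<zero>\<^bsub>K\<^esub>} \<subseteq> S"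
      using supp fg by (auto simp: S_def)
    have fgS: "{p. (f \<oplus>\<^bsub>free_mod K X\<^esub> g) p \<noteq> \<zero>\<^bsub>K\<^esub>} \<subseteq> S"
      by (auto simp: free_mod_sel(3) S_def)
    have c: "f p \<in> carrier K" "g p \<in> carrier K" for p by (rule cl[OF fg(1)], rule cl[OF fg(2)])
    have \<beta>S: "\<beta> p \<in> carrier U" if "p \<in> S" for p using S \<beta> that by auto
    have "free_lift K U \<beta> (f \<oplus>\<^bsub>free_mod K X\<^esub> g) = (\<Oplus>\<^bsub>U\<^esub>p \<in> S. (f p \<oplus>\<^bsub>K\<^esub> g p) \<odot>\<^bsub>U\<^esub> \<beta> p)"
      by (subst free_lift_superset[OF assms F.a_closed[OF fg] S fgS]) (simp add: free_mod_sel(3))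
    also have "\<dots> = (\<Oplus>\<^bsub>U\<^esub>p \<in> S. f p \<odot>\<^bsub>U\<^esub> \<beta> p \<oplus>\<^bsub>U\<^esub> g p \<odot>\<^bsub>U\<^esub> \<beta> p)"
      by (intro U.finsum_cong' Pi_I refl U.smult_l_distr) (simp_all add: c \<beta>S)
    also have "\<dots> = (\<Oplus>\<^bsub>U\<^esub>p \<in> S. f p \<odot>\<^bsub>U\<^esub> \<beta> p) \<oplus>\<^bsub>U\<^esub> (\<Oplus>\<^bsub>U\<^esub>p \<in> S. g p \<odot>\<^bsub>U\<^esub> \<beta> p)"
      by (intro U.finsum_addf Pi_I) (simp_all add: c \<beta>S)
    also have "\<dots> = free_lift K U \<beta> f \<oplus>\<^bsub>U\<^esub> free_lift K U \<beta> g"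
      unfolding free_lift_superset[OF assms fg(1) S fS] free_lift_superset[OF assms fg(2) S gS] ..
    finally show "free_lift K U \<beta> (f \<oplus>\<^bsub>free_mod K X\<^esub> g) = free_lift K U \<beta> f \<oplus>\<^bsub>U\<^esub> free_lift K U \<beta> g" .
  next
    fix a f assume af: "a \<in> carrier K" "f \<in> carrier (free_mod K X)"
    define S where "S = {p. f p \<noteq> \<zero>\<^bsub>K\<^esub>}"
    have S: "finite S" "S \<subseteq> X" using supp[OF af(2)] by (auto simp: S_def)
    have c: "f p \<in> carrier K" for p by (rule cl[OF af(2)])
    have afS: "{p. (a \<odot>\<^bsub>free_mod K X\<^esub> f) p \<noteq> \<zero>\<^bsub>K\<^esub>} \<subseteq> S"
      using af by (auto simp: free_mod_sel(4) S_def)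
    have \<beta>S: "\<beta> p \<in> carrier U" if "p \<in> S" for p using S \<beta> that by auto
    have "free_lift K U \<beta> (a \<odot>\<^bsub>free_mod K X\<^esub> f) = (\<Oplus>\<^bsub>U\<^esub>p \<in> S. (a \<otimes>\<^bsub>K\<^esub> f p) \<odot>\<^bsub>U\<^esub> \<beta> p)"
      by (subst free_lift_superset[OF assms F.smult_closed[OF af] S afS]) (simp add: free_mod_sel(4))
    also have "\<dots> = (\<Oplus>\<^bsub>U\<^esub>p \<in> S. a \<odot>\<^bsub>U\<^esub> (f p \<odot>\<^bsub>U\<^esub> \<beta> p))"
      by (intro U.finsum_cong' Pi_I refl U.smult_assoc1) (simp_all add: c \<beta>S af)
    also have "\<dots> = a \<odot>\<^bsub>U\<^esub> free_lift K U \<beta> f"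
      unfolding free_lift_def S_def[symmetric]
      by (intro U.finsum_smult_ldistr[symmetric] S Pi_I) (simp_all add: c \<beta>S af)
    finally show "free_lift K U \<beta> (a \<odot>\<^bsub>free_mod K X\<^esub> f) = a \<odot>\<^bsub>U\<^esub> free_lift K U \<beta> f" .
  qed
qed

lemma free_lift_gen:
  assumes "module K U" "\<beta> \<in> X \<rightarrow> carrier U" "x \<in> X"
  shows "free_lift K U \<beta> (free_gen K x) = \<beta> x"
proof -
  interpret U: module K U by fact
  have "free_lift K U \<beta> (free_gen K x) = (\<Oplus>\<^bsub>U\<^esub>p \<in> {x}. free_gen K x p \<odot>\<^bsub>U\<^esub> \<beta> p)"
    using free_gen_closed[OF U.is_cring assms(3)] assms(3)
    by (subst free_lift_superset[OF assms(1,2), of _ "{x}"]) (auto simp: free_gen_def)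
  also have "\<dots> = \<beta> x" using assms by (auto simp: free_gen_def Pi_iff)
  finally show ?thesis .
qed

section \<open>Bilinear maps and the universal property of the tensor product\<close>

definition bilin ::
  "('k, 'm) ring_scheme \<Rightarrow> ('k, 'v, 'p) module_scheme \<Rightarrow> ('k, 'w, 'q) module_scheme
   \<Rightarrow> ('k, 'u, 'r) module_scheme \<Rightarrow> ('v \<Rightarrow> 'w \<Rightarrow> 'u) \<Rightarrow> bool"
  where "bilin K V W U \<beta> \<longleftrightarrow>
    (\<forall>x \<in> carrier V. \<beta> x \<in> lin K W U) \<and> (\<forall>y \<in> carrier W. (\<lambda>x. \<beta> x y) \<in> lin K V U)"

lemma bilin_right: "bilin K V W U \<beta> \<Longrightarrow> x \<in> carrier V \<Longrightarrow> \<beta> x \<in> lin K W U"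
  and bilin_left: "bilin K V W U \<beta> \<Longrightarrow> y \<in> carrier W \<Longrightarrow> (\<lambda>x. \<beta> x y) \<in> lin K V U"
  by (auto simp: bilin_def)

lemma bilin_closed: "bilin K V W U \<beta> \<Longrightarrow> x \<in> carrier V \<Longrightarrow> y \<in> carrier W \<Longrightarrow> \<beta> x y \<in> carrier U"
  by (auto simp: bilin_def intro: lin_closed)

lemma bilin_comp:
  assumes "bilin K V W U \<beta>" "f \<in> lin K V' V" "g \<in> lin K W' W"
  shows "bilin K V' W' U (\<lambda>x y. \<beta> (f x) (g y))"
  using assms unfolding bilin_def
  by (auto intro: lin_comp[where g = "\<beta> _"] lin_comp[where g = "\<lambda>x. \<beta> x _"] dest: lin_closed)

context
  fixes K :: "('k, 'm) ring_scheme" and V :: "('k, 'v, 'p) module_scheme"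
    and W :: "('k, 'w, 'q) module_scheme"
  assumes V: "module K V" and W: "module K W"
begin

interpretation V: module K V by (rule V)
interpretation W: module K W by (rule W)

lemma free_mod_pairs_module: "module K (free_mod K (carrier V \<times> carrier W))"
  by (rule free_mod_module[OF V.is_cring])

interpretation F: module K "free_mod K (carrier V \<times> carrier W)" by (rule free_mod_pairs_module)

lemma free_gen_pair_closed:
  "x \<in> carrier V \<Longrightarrow> y \<in> carrier W \<Longrightarrow> free_gen K (x, y) \<in> carrier (free_mod K (carrier V \<times> carrier W))"
  by (rule free_gen_closed[OF V.is_cring]) simp

lemma tensor_rels_submodule: "submodule (tensor_rels K V W) K (free_mod K (carrier V \<times> carrier W))"
  unfolding tensor_rels_def Let_def
  by (rule lspan_submodule[OF free_mod_pairs_module]) (auto intro!: free_gen_pair_closed)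

lemmas tensor_module = quot_module[OF free_mod_pairs_module tensor_rels_submodule, folded tensor_def]

lemma pure_closed: "x \<in> carrier V \<Longrightarrow> y \<in> carrier W \<Longrightarrow> pure K V W x y \<in> carrier (tensor K V W)"
  unfolding pure_def tensor_def
  by (rule lin_closed[OF qmap_lin[OF free_mod_pairs_module tensor_rels_submodule]])
    (rule free_gen_pair_closed)

lemma tensor_relsI:
  fixes F g defines "F \<equiv> free_mod K (carrier V \<times> carrier W)" and "g \<equiv> free_gen K"
  shows "x \<in> carrier V \<Longrightarrow> x' \<in> carrier V \<Longrightarrow> y \<in> carrier W \<Longrightarrow>
      g (x \<oplus>\<^bsub>V\<^esub> x', y) \<ominus>\<^bsub>F\<^esub> (g (x, y) \<oplus>\<^bsub>F\<^esub> g (x', y)) \<in> tensor_rels K V W"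
    and "x \<in> carrier V \<Longrightarrow> y \<in> carrier W \<Longrightarrow> y' \<in> carrier W \<Longrightarrow>
      g (x, y \<oplus>\<^bsub>W\<^esub> y') \<ominus>\<^bsub>F\<^esub> (g (x, y) \<oplus>\<^bsub>F\<^esub> g (x, y')) \<in> tensor_rels K V W"
    and "c \<in> carrier K \<Longrightarrow> x \<in> carrier V \<Longrightarrow> y \<in> carrier W \<Longrightarrow>
      g (c \<odot>\<^bsub>V\<^esub> x, y) \<ominus>\<^bsub>F\<^esub> (c \<odot>\<^bsub>F\<^esub> g (x, y)) \<in> tensor_rels K V W"
    and "c \<in> carrier K \<Longrightarrow> x \<in> carrier V \<Longrightarrow> y \<in> carrier W \<Longrightarrow>
      g (x, c \<odot>\<^bsub>W\<^esub> y) \<ominus>\<^bsub>F\<^esub> (c \<odot>\<^bsub>F\<^esub> g (x, y)) \<in> tensor_rels K V W"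
  unfolding tensor_rels_def Let_def F_def g_def
  by (rule subsetD[OF lspan_superset], blast)+

lemma pure_bilin: "bilin K V W (tensor K V W) (pure K V W)"
proof -
  note q = qmap_add[OF free_mod_pairs_module tensor_rels_submodule]
    qmap_smult[OF free_mod_pairs_module tensor_rels_submodule]
  note eq = qmap_eq_iff[OF free_mod_pairs_module tensor_rels_submodule, THEN iffD2]
  note gen = free_gen_pair_closed
  show ?thesis
    unfolding bilin_def
  proof (intro conjI ballI linI; (rule pure_closed; assumption)?)
    fix x y y' assume xy: "x \<in> carrier V" "y \<in> carrier W" "y' \<in> carrier W"
    show "pure K V W x (y \<oplus>\<^bsub>W\<^esub> y') = pure K V W x y \<oplus>\<^bsub>tensor K V W\<^esub> pure K V W x y'"
      unfolding pure_def tensor_def q(1)[OF gen gen, OF xy(1,2) xy(1,3), symmetric]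
      by (rule eq[OF _ _ tensor_relsI(2)[OF xy]]) (auto intro!: gen xy)
  next
    fix x c y assume xy: "x \<in> carrier V" "c \<in> carrier K" "y \<in> carrier W"
    show "pure K V W x (c \<odot>\<^bsub>W\<^esub> y) = c \<odot>\<^bsub>tensor K V W\<^esub> pure K V W x y"
      unfolding pure_def tensor_def q(2)[OF xy(2) gen, OF xy(1,3), symmetric]
      by (rule eq[OF _ _ tensor_relsI(4)[OF xy(2,1,3)]]) (auto intro!: gen xy)
  next
    fix y x x' assume xy: "y \<in> carrier W" "x \<in> carrier V" "x' \<in> carrier V"
    show "pure K V W (x \<oplus>\<^bsub>V\<^esub> x') y = pure K V W x y \<oplus>\<^bsub>tensor K V W\<^esub> pure K V W x' y"
      unfolding pure_def tensor_def q(1)[OF gen gen, OF xy(2,1) xy(3,1), symmetric]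
      by (rule eq[OF _ _ tensor_relsI(1)[OF xy(2,3,1)]]) (auto intro!: gen xy)
  next
    fix y c x assume xy: "y \<in> carrier W" "c \<in> carrier K" "x \<in> carrier V"
    show "pure K V W (c \<odot>\<^bsub>V\<^esub> x) y = c \<odot>\<^bsub>tensor K V W\<^esub> pure K V W x y"
      unfolding pure_def tensor_def q(2)[OF xy(2) gen, OF xy(3,1), symmetric]
      by (rule eq[OF _ _ tensor_relsI(3)[OF xy(2,3,1)]]) (auto intro!: gen xy)
  qed
qed

text \<open>Pulled back along the quotient map, \<open>U\<close> becomes a submodule of the free
  module that contains all generators, hence everything. This induction principle replaces writing a
  tensor as a finite sum of pure ones.\<close>

lemma tensor_spanned:
  assumes "submodule U K (tensor K V W)"
    and "\<And>x y. x \<in> carrier V \<Longrightarrow> y \<in> carrier W \<Longrightarrow> pure K V W x y \<in> U"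
    and "t \<in> carrier (tensor K V W)"
  shows "t \<in> U"
proof -
  let ?F = "free_mod K (carrier V \<times> carrier W)" and ?q = "qmap (free_mod K (carrier V \<times> carrier W)) (tensor_rels K V W)"
  have q: "?q \<in> lin K ?F (tensor K V W)"
    unfolding tensor_def by (rule qmap_lin[OF free_mod_pairs_module tensor_rels_submodule])
  obtain f where f: "f \<in> carrier ?F" "t = ?q f"
    using assms(3) quot_sel(1)[OF free_mod_pairs_module tensor_rels_submodule] by (auto simp: tensor_def)
  have "f \<in> {f \<in> carrier ?F. ?q f \<in> U}"
  proof (rule free_mod_spanned[OF V.is_cring submodule_vimage[OF free_mod_pairs_module tensor_module q assms(1)] _ f(1)])
    fix p assume "p \<in> carrier V \<times> carrier W"
    then show "free_gen K p \<in> {f \<in> carrier ?F. ?q f \<in> U}"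
      using assms(2) by (auto intro: free_gen_pair_closed simp: pure_def)
  qed
  then show ?thesis using f by simp
qed

text \<open>The equalizer of two linear maps is a submodule, so agreement on pure tensors spreads to
  all tensors.\<close>

lemma tensor_lin_eqI:
  assumes "module K U" "f \<in> lin K (tensor K V W) U" "g \<in> lin K (tensor K V W) U"
    and "\<And>x y. x \<in> carrier V \<Longrightarrow> y \<in> carrier W \<Longrightarrow> f (pure K V W x y) = g (pure K V W x y)"
    and "t \<in> carrier (tensor K V W)"
  shows "f t = g t"
  using tensor_spanned[OF submodule_equalizer[OF tensor_module assms(1-3)] _ assms(5)] assms(4)
  by (auto intro: pure_closed)

context
  fixes U :: "('k, 'u, 'r) module_scheme" and \<beta>
  assumes U: "module K U" and \<beta>: "bilin K V W U \<beta>"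
begin

interpretation U: module K U by (rule U)

lemma tlift_alt:
  "tlift K V W U \<beta> = qlift (free_mod K (carrier V \<times> carrier W)) (tensor_rels K V W)
    (free_lift K U (\<lambda>p. \<beta> (fst p) (snd p)))"
  unfolding tlift_def free_lift_def ..

lemma free_lift_bilin_lin:
  "free_lift K U (\<lambda>p. \<beta> (fst p) (snd p)) \<in> lin K (free_mod K (carrier V \<times> carrier W)) U"
  by (rule free_lift_lin[OF U]) (auto intro: bilin_closed[OF \<beta>])

lemma free_lift_bilin_gen:
  "x \<in> carrier V \<Longrightarrow> y \<in> carrier W \<Longrightarrow>
    free_lift K U (\<lambda>p. \<beta> (fst p) (snd p)) (free_gen K (x, y)) = \<beta> x y"
  by (subst free_lift_gen[OF U, of _ "carrier V \<times> carrier W"]) (auto intro: bilin_closed[OF \<beta>])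

text \<open>The kernel of the lift is a submodule, so only the generating relations have to be
  checked, and each of their four families expresses one law of bilinearity.\<close>

lemma free_lift_rels:
  assumes "u \<in> tensor_rels K V W"
  shows "free_lift K U (\<lambda>p. \<beta> (fst p) (snd p)) u = \<zero>\<^bsub>U\<^esub>"
proof -
  let ?F = "free_mod K (carrier V \<times> carrier W)"
  note \<phi> = free_lift_bilin_lin
  note [simp] = lin_minus[OF free_mod_pairs_module U \<phi>] lin_add[OF \<phi>] lin_smult[OF \<phi>]
    lin_closed[OF \<phi>] free_lift_bilin_gen free_gen_pair_closed bilin_closed[OF \<beta>]
    lin_add[OF bilin_left[OF \<beta>]] lin_add[OF bilin_right[OF \<beta>]]
    lin_smult[OF bilin_left[OF \<beta>]] lin_smult[OF bilin_right[OF \<beta>]]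
  have "tensor_rels K V W \<subseteq> {f \<in> carrier ?F. free_lift K U (\<lambda>p. \<beta> (fst p) (snd p)) f = \<zero>\<^bsub>U\<^esub>}"
    unfolding tensor_rels_def Let_def
  proof (rule lspan_least)
    show "submodule {f \<in> carrier ?F. free_lift K U (\<lambda>p. \<beta> (fst p) (snd p)) f = \<zero>\<^bsub>U\<^esub>} K ?F"
      by (rule submodule_kernel[OF free_mod_pairs_module U \<phi>])
  qed (auto simp: U.r_neg a_minus_def[of U])
  then show ?thesis using assms by auto
qed

lemma tlift_lin: "tlift K V W U \<beta> \<in> lin K (tensor K V W) U"
  unfolding tlift_alt tensor_def
  by (rule qlift_lin[OF free_mod_pairs_module tensor_rels_submodule U free_lift_bilin_lin free_lift_rels])

lemma tlift_pure:
  assumes "x \<in> carrier V" "y \<in> carrier W"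
  shows "tlift K V W U \<beta> (pure K V W x y) = \<beta> x y"
  unfolding tlift_alt pure_def
  by (subst qlift_qmap[OF free_mod_pairs_module tensor_rels_submodule U free_lift_bilin_lin free_lift_rels])
    (auto simp: free_lift_bilin_gen assms intro!: free_gen_pair_closed[OF assms])

end

text \<open>This handles nested lifts, where the integrand of the inner one depends on an outer
  variable \<open>p\<close> while \<open>t\<close> is an arbitrary tensor. For fixed parameters both
  sides of each linearity law are linear in \<open>t\<close>, so the law may be checked on pure
  tensors, where it is linearity of the integrand in \<open>p\<close>.\<close>

lemma tlift_param_lin:
  fixes U :: "('k, 'u, 'r) module_scheme" and P :: "('k, 'x, 'y) module_scheme"
  assumes U: "module K U" and P: "module K P"
    and \<beta>: "\<And>p. p \<in> carrier P \<Longrightarrow> bilin K V W U (\<beta> p)"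
    and lin: "\<And>x y. x \<in> carrier V \<Longrightarrow> y \<in> carrier W \<Longrightarrow> (\<lambda>p. \<beta> p x y) \<in> lin K P U"
    and t: "t \<in> carrier (tensor K V W)"
  shows "(\<lambda>p. tlift K V W U (\<beta> p) t) \<in> lin K P U"
proof -
  interpret U: module K U by (rule U)
  interpret P: module K P by (rule P)
  note l = tlift_lin[OF U \<beta>]
  \<comment> \<open>Commutativity of \<open>K\<close> is what makes a scalar multiple of a linear
    map linear.\<close>
  have smult: "(\<lambda>t. c \<odot>\<^bsub>U\<^esub> f t) \<in> lin K (tensor K V W) U"
    if "f \<in> lin K (tensor K V W) U" "c \<in> carrier K" for c f
    using that by (intro linI)
      (auto simp: lin_closed lin_add lin_smult U.smult_r_distr U.smult_assoc1[symmetric] V.R.m_comm)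
  show ?thesis
  proof (rule linI)
    fix p assume "p \<in> carrier P"
    then show "tlift K V W U (\<beta> p) t \<in> carrier U" using lin_closed[OF l] t by auto
  next
    fix p p' assume p: "p \<in> carrier P" "p' \<in> carrier P"
    show "tlift K V W U (\<beta> (p \<oplus>\<^bsub>P\<^esub> p')) t = tlift K V W U (\<beta> p) t \<oplus>\<^bsub>U\<^esub> tlift K V W U (\<beta> p') t"
      by (rule tensor_lin_eqI[OF U l lin_plus[OF U l l] _ t])
        (simp_all add: p tlift_pure[OF U \<beta>] lin_add[OF lin])
  next
    fix c p assume p: "c \<in> carrier K" "p \<in> carrier P"
    show "tlift K V W U (\<beta> (c \<odot>\<^bsub>P\<^esub> p)) t = c \<odot>\<^bsub>U\<^esub> tlift K V W U (\<beta> p) t"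
      by (rule tensor_lin_eqI[OF U l smult[OF l p(1)] _ t])
        (simp_all add: p tlift_pure[OF U \<beta>] lin_smult[OF lin])
  qed
qed

lemma tlift_param_bilin:
  fixes U :: "('k, 'u, 'r) module_scheme" and P :: "('k, 'x, 'y) module_scheme"
  assumes U: "module K U" and P: "module K P"
    and \<beta>: "\<And>p. p \<in> carrier P \<Longrightarrow> bilin K V W U (\<beta> p)"
    and lin: "\<And>x y. x \<in> carrier V \<Longrightarrow> y \<in> carrier W \<Longrightarrow> (\<lambda>p. \<beta> p x y) \<in> lin K P U"
  shows "bilin K P (tensor K V W) U (\<lambda>p. tlift K V W U (\<beta> p))"
  unfolding bilin_def using tlift_lin[OF U \<beta>] tlift_param_lin[OF assms] by blast

end

section \<open>The vertical map\<close>

lemma k_algebra_mult_bilin: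
  assumes "k_algebra K A"
  shows "bilin K A A A (\<lambda>x y. x \<otimes>\<^bsub>A\<^esub> y)"
proof -
  interpret ring A using assms by (simp add: k_algebra_def)
  show ?thesis using assms
    unfolding bilin_def by (intro conjI ballI linI) (auto simp: k_algebra_def l_distr r_distr)
qed

lemma lin_id: "id \<in> lin K V V"
  by (auto simp: lin_def)

lemma tsub_submodule:
  assumes "module K V" "module K W" "X \<subseteq> carrier V" "Y \<subseteq> carrier W"
  shows "submodule (tsub K V W X Y) K (tensor K V W)"
  unfolding tsub_def using assms
  by (intro lspan_submodule tensor_module) (auto intro!: pure_closed)

lemma pure_in_tsub: "x \<in> X \<Longrightarrow> y \<in> Y \<Longrightarrow> pure K V W x y \<in> tsub K V W X Y"
  unfolding tsub_def by (rule subsetD[OF lspan_superset]) blast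

section \<open>The augmentation ideal and the projection onto it\<close>

context
  fixes K :: "('k, 'm) ring_scheme" and H :: "('k, 'h) hopf"
  assumes H: "bialgebra K H"
begin

lemma bialgebra_module: "module K H"
  using H by (simp add: bialgebra_def k_algebra_def)

interpretation H: module K H by (rule bialgebra_module)
interpretation Hr: ring H using H by (simp add: bialgebra_def k_algebra_def)

lemma counit_closed: "h \<in> carrier H \<Longrightarrow> counit H h \<in> carrier K"
  and counit_add: "g \<in> carrier H \<Longrightarrow> h \<in> carrier H \<Longrightarrow> counit H (g \<oplus>\<^bsub>H\<^esub> h) = counit H g \<oplus>\<^bsub>K\<^esub> counit H h"
  and counit_smult: "c \<in> carrier K \<Longrightarrow> h \<in> carrier H \<Longrightarrow> counit H (c \<odot>\<^bsub>H\<^esub> h) = c \<otimes>\<^bsub>K\<^esub> counit H h"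
  and counit_mult: "g \<in> carrier H \<Longrightarrow> h \<in> carrier H \<Longrightarrow> counit H (g \<otimes>\<^bsub>H\<^esub> h) = counit H g \<otimes>\<^bsub>K\<^esub> counit H h"
  and counit_one: "counit H \<one>\<^bsub>H\<^esub> = \<one>\<^bsub>K\<^esub>"
  using H by (auto simp: bialgebra_def coalgebra_def lin_def ground_def)

lemma counit_zero: "counit H \<zero>\<^bsub>H\<^esub> = \<zero>\<^bsub>K\<^esub>"
  using counit_smult[of "\<zero>\<^bsub>K\<^esub>" "\<zero>\<^bsub>H\<^esub>"] counit_closed by simp

lemma aug_submodule: "submodule (aug K H) K H"
  by (auto simp: submodule_iff[OF bialgebra_module] aug_def counit_zero counit_add counit_smult)

lemmas Hplus_module = module_on_sub[OF bialgebra_module aug_submodule]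

lemma plus_part_lin: "plus_part H \<in> lin K H (Hplus K H)"
proof -
  \<comment> \<open>Turning the subtraction into the addition of a scalar multiple of the unit gives
    the form that \<open>lin_plus\<close> accepts.\<close>
  have alt: "plus_part H h = h \<oplus>\<^bsub>H\<^esub> (\<ominus>\<^bsub>K\<^esub> counit H h) \<odot>\<^bsub>H\<^esub> \<one>\<^bsub>H\<^esub>" if "h \<in> carrier H" for h
    using that by (simp add: plus_part_def a_minus_def H.smult_l_minus counit_closed)
  have "(\<lambda>h. h \<oplus>\<^bsub>H\<^esub> (\<ominus>\<^bsub>K\<^esub> counit H h) \<odot>\<^bsub>H\<^esub> \<one>\<^bsub>H\<^esub>) \<in> lin K H H"
  proof (rule lin_plus[OF bialgebra_module])
    show "(\<lambda>h. h) \<in> lin K H H" by (auto simp: lin_def)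
    show "(\<lambda>h. (\<ominus>\<^bsub>K\<^esub> counit H h) \<odot>\<^bsub>H\<^esub> \<one>\<^bsub>H\<^esub>) \<in> lin K H H"
      by (intro linI) (simp_all add: counit_closed counit_add counit_smult H.R.minus_add
          H.smult_l_distr H.smult_assoc1[symmetric] H.R.r_minus)
  qed
  then have lin: "plus_part H \<in> lin K H H"
    by (rule lin_cong[OF bialgebra_module]) (rule alt)
  \<comment> \<open>\<open>\<epsilon>(h) - \<epsilon>(h) \<epsilon>(1) = 0\<close>, so linearity
    into \<open>H\<close> can be sharpened to linearity into the smaller carrier.\<close>
  have "counit H (plus_part H h) = \<zero>\<^bsub>K\<^esub>" if "h \<in> carrier H" for h
    using that by (simp add: alt counit_closed counit_add counit_smult counit_one H.R.r_neg)
  then show ?thesis using lin by (auto simp: lin_def aug_def)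
qed

lemma plus_part_closed: "h \<in> carrier H \<Longrightarrow> plus_part H h \<in> aug K H"
  using lin_closed[OF plus_part_lin] by simp

lemma aug_closed: "h \<in> aug K H \<Longrightarrow> h \<in> carrier H"
  by (simp add: aug_def)

lemma plus_part_one: "plus_part H \<one>\<^bsub>H\<^esub> = \<zero>\<^bsub>H\<^esub>"
  by (simp add: plus_part_def counit_one a_minus_def H.r_neg)

lemma aug_mult: "g \<in> aug K H \<Longrightarrow> h \<in> carrier H \<Longrightarrow> g \<otimes>\<^bsub>H\<^esub> h \<in> aug K H"
  by (auto simp: aug_def counit_mult counit_closed)

text \<open>The right-hand side expands to \<open>gh - \<epsilon>(g) h + \<epsilon>(g) h -
  \<epsilon>(g) \<epsilon>(h) 1\<close>. The middle terms cancel, and the counit is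
  multiplicative.\<close>

lemma plus_part_mult:
  assumes g: "g \<in> carrier H" and h: "h \<in> carrier H"
  shows "plus_part H (g \<otimes>\<^bsub>H\<^esub> h) = plus_part H g \<otimes>\<^bsub>H\<^esub> h \<oplus>\<^bsub>H\<^esub> counit H g \<odot>\<^bsub>H\<^esub> plus_part H h"
proof -
  have alg: "(c \<odot>\<^bsub>H\<^esub> x) \<otimes>\<^bsub>H\<^esub> y = c \<odot>\<^bsub>H\<^esub> (x \<otimes>\<^bsub>H\<^esub> y)"
    if "c \<in> carrier K" "x \<in> carrier H" "y \<in> carrier H" for c x y
    using H that by (simp add: bialgebra_def k_algebra_def)
  define e f where "e = counit H g" and "f = counit H h"
  have ef: "e \<in> carrier K" "f \<in> carrier K" using g h by (simp_all add: e_def f_def counit_closed)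
  have "plus_part H g \<otimes>\<^bsub>H\<^esub> h \<oplus>\<^bsub>H\<^esub> e \<odot>\<^bsub>H\<^esub> plus_part H h
     = (g \<otimes>\<^bsub>H\<^esub> h \<ominus>\<^bsub>H\<^esub> e \<odot>\<^bsub>H\<^esub> h) \<oplus>\<^bsub>H\<^esub> (e \<odot>\<^bsub>H\<^esub> h \<ominus>\<^bsub>H\<^esub> (e \<otimes>\<^bsub>K\<^esub> f) \<odot>\<^bsub>H\<^esub> \<one>\<^bsub>H\<^esub>)"
    using g h ef by (simp add: plus_part_def e_def[symmetric] f_def[symmetric] a_minus_def alg
        Hr.l_distr Hr.l_minus H.smult_r_distr H.smult_r_minus H.smult_assoc1)
  also have "\<dots> = g \<otimes>\<^bsub>H\<^esub> h \<ominus>\<^bsub>H\<^esub> (e \<otimes>\<^bsub>K\<^esub> f) \<odot>\<^bsub>H\<^esub> \<one>\<^bsub>H\<^esub>"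
    using g h ef by (simp add: a_minus_def H.a_assoc H.r_neg1 H.r_neg2)
  finally show ?thesis
    using g h by (simp add: plus_part_def[of H "g \<otimes>\<^bsub>H\<^esub> h"] counit_mult e_def f_def)
qed

text \<open>\<open>right_ideal\<close> demands an additive subgroup only. Scalars come for free from
  the unit of \<open>H\<close>: \<open>c x = x (c 1)\<close>, a right multiple of
  \<open>x\<close>.\<close>

lemma right_ideal_submodule:
  assumes "right_ideal H I" "I \<subseteq> aug K H"
  shows "submodule I K (Hplus K H)"
proof -
  interpret I: additive_subgroup I H using assms by (simp add: right_ideal_def)
  have "c \<odot>\<^bsub>H\<^esub> x \<in> I" if "c \<in> carrier K" "x \<in> I" for c x
  proof -
    have x: "x \<in> carrier H" using that I.a_subset by auto
    have "x \<otimes>\<^bsub>H\<^esub> (c \<odot>\<^bsub>H\<^esub> \<one>\<^bsub>H\<^esub>) = c \<odot>\<^bsub>H\<^esub> (x \<otimes>\<^bsub>H\<^esub> \<one>\<^bsub>H\<^esub>)"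
      using H x that by (simp add: bialgebra_def k_algebra_def)
    then have "c \<odot>\<^bsub>H\<^esub> x = x \<otimes>\<^bsub>H\<^esub> (c \<odot>\<^bsub>H\<^esub> \<one>\<^bsub>H\<^esub>)" using x by simp
    then show ?thesis using assms that by (simp add: right_ideal_def)
  qed
  then show ?thesis
    using assms(2) by (auto simp: submodule_iff[OF Hplus_module])
qed

section \<open>Comodule algebras: structure maps and the vertical map\<close>

context
  fixes A :: "('k, 'h, 'a) comod_alg"
  assumes A: "comodule_algebra K H A"
begin

lemma comodule_algebra_module: "module K A"
  using A by (simp add: comodule_algebra_def k_algebra_def)

interpretation A: module K A by (rule comodule_algebra_module)
interpretation Ar: ring A using A by (simp add: comodule_algebra_def k_algebra_def)

abbreviation (input) "P \<equiv> Hplus K H"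
abbreviation (input) "AH \<equiv> tensor K A H"
abbreviation (input) "AP \<equiv> tensor K A (Hplus K H)"

lemmas mA = comodule_algebra_module and mH = bialgebra_module and mP = Hplus_module
lemmas mAA = tensor_module[OF mA mA] and mAH = tensor_module[OF mA mH] and mAP = tensor_module[OF mA mP]
lemmas pure_AP_bilin = pure_bilin[OF mA mP]

interpretation AP: module K AP by (rule mAP)

lemma mult_A_bilin: "bilin K A A A (\<lambda>x y. x \<otimes>\<^bsub>A\<^esub> y)"
  using A by (intro k_algebra_mult_bilin) (simp add: comodule_algebra_def)

lemma mult_H_bilin: "bilin K H H H (\<lambda>x y. x \<otimes>\<^bsub>H\<^esub> y)"
  using H by (intro k_algebra_mult_bilin) (simp add: bialgebra_def)

text \<open>The carriers differ on purpose: the right factor will be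
  \<open>c\<^sub>(\<^sub>1\<^sub>)\<close>, which need not have counit zero, while the product stays
  in \<open>H\<^sup>+\<close> because \<open>H\<^sup>+\<close> is an ideal.\<close>

lemma mult_P_bilin: "bilin K P H P (\<lambda>x y. x \<otimes>\<^bsub>H\<^esub> y)"
  using mult_H_bilin by (auto simp: bilin_def lin_def aug_mult aug_closed)

lemma coact_lin: "coact A \<in> lin K A AH"
  using A by (simp add: comodule_algebra_def)

lemmas coact_closed = lin_closed[OF coact_lin]

text \<open>This is the inner lift of \<open>ver_u\<close>, with \<open>coact A a'\<close> replaced
  by a free argument from \<open>A \<otimes> H\<close>. That freedom allows identities to be tested
  on pure \<open>x \<otimes> h\<close>.\<close>

definition ver_leg :: "'a \<Rightarrow> ('k, 'a, 'h) tens \<Rightarrow> ('k, 'a, 'h) tens"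
  where "ver_leg a = tlift K A H AP (\<lambda>x h. pure K A P (a \<otimes>\<^bsub>A\<^esub> x) (plus_part H h))"

lemma ver_leg_aux:
  assumes "a \<in> carrier A"
  shows "bilin K A H AP (\<lambda>x h. pure K A P (a \<otimes>\<^bsub>A\<^esub> x) (plus_part H h))"
  by (rule bilin_comp[OF pure_AP_bilin bilin_right[OF mult_A_bilin assms] plus_part_lin])

lemma ver_leg_bilin: "bilin K A AH AP ver_leg"
  unfolding ver_leg_def
proof (rule tlift_param_bilin[OF mA mH mAP mA ver_leg_aux])
  fix x h assume "x \<in> carrier A" "h \<in> carrier H"
  then show "(\<lambda>a. pure K A P (a \<otimes>\<^bsub>A\<^esub> x) (plus_part H h)) \<in> lin K A AP"
    using plus_part_closed
    by (intro lin_comp[OF bilin_left[OF mult_A_bilin] bilin_left[OF pure_AP_bilin]]) auto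
qed

lemma ver_leg_pure:
  "a \<in> carrier A \<Longrightarrow> x \<in> carrier A \<Longrightarrow> h \<in> carrier H \<Longrightarrow>
    ver_leg a (pure K A H x h) = pure K A P (a \<otimes>\<^bsub>A\<^esub> x) (plus_part H h)"
  unfolding ver_leg_def by (rule tlift_pure[OF mA mH mAP ver_leg_aux])

lemma ver_u_alt: "ver_u K H A = tlift K A A AP (\<lambda>a a'. ver_leg a (coact A a'))"
  by (simp add: ver_u_def ver_leg_def Let_def)

lemma ver_u_aux: "bilin K A A AP (\<lambda>a a'. ver_leg a (coact A a'))"
  using bilin_comp[OF ver_leg_bilin lin_id coact_lin] by simp

lemma ver_u_lin: "ver_u K H A \<in> lin K (AA K A) AP"
  unfolding ver_u_alt by (rule tlift_lin[OF mA mA mAP ver_u_aux])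

lemma ver_u_pure:
  "a \<in> carrier A \<Longrightarrow> a' \<in> carrier A \<Longrightarrow> ver_u K H A (pure K A A a a') = ver_leg a (coact A a')"
  unfolding ver_u_alt by (rule tlift_pure[OF mA mA mAP ver_u_aux])

section \<open>Multiplication and bimodule structure of \<open>A \<otimes> A\<close>\<close>

lemma mul_lin: "mul K A \<in> lin K (AA K A) A"
  unfolding mul_def by (rule tlift_lin[OF mA mA mA mult_A_bilin])

lemma mul_pure: "a \<in> carrier A \<Longrightarrow> a' \<in> carrier A \<Longrightarrow> mul K A (pure K A A a a') = a \<otimes>\<^bsub>A\<^esub> a'"
  unfolding mul_def by (rule tlift_pure[OF mA mA mA mult_A_bilin])

text \<open>\<open>W\<close> is left open because the same formula gives the left action of
  \<open>A\<close> on \<open>A \<otimes> A\<close> and on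
  \<open>A \<otimes> H\<^sup>+\<close>.\<close>

lemma lmult_bilin:
  assumes "c \<in> carrier A" "module K W"
  shows "bilin K A W (tensor K A W) (\<lambda>x y. pure K A W (c \<otimes>\<^bsub>A\<^esub> x) y)"
  using bilin_comp[OF pure_bilin[OF mA assms(2)] bilin_right[OF mult_A_bilin assms(1)] lin_id] by simp

lemma ract_aux:
  assumes "c \<in> carrier A"
  shows "bilin K A A (AA K A) (\<lambda>x y. pure K A A x (y \<otimes>\<^bsub>A\<^esub> c))"
  using bilin_comp[OF pure_bilin[OF mA mA] lin_id bilin_left[OF mult_A_bilin assms]] by simp

lemma lact_lin: "c \<in> carrier A \<Longrightarrow> lact K A c \<in> lin K (AA K A) (AA K A)"
  and lact_pure: "c \<in> carrier A \<Longrightarrow> a \<in> carrier A \<Longrightarrow> a' \<in> carrier A \<Longrightarrow>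
    lact K A c (pure K A A a a') = pure K A A (c \<otimes>\<^bsub>A\<^esub> a) a'"
  unfolding lact_def
  by (rule tlift_lin[OF mA mA mAA lmult_bilin[OF _ mA]] tlift_pure[OF mA mA mAA lmult_bilin[OF _ mA]];
      assumption)+

lemma ract_lin: "c \<in> carrier A \<Longrightarrow> ract K A c \<in> lin K (AA K A) (AA K A)"
  and ract_pure: "c \<in> carrier A \<Longrightarrow> a \<in> carrier A \<Longrightarrow> a' \<in> carrier A \<Longrightarrow>
    ract K A c (pure K A A a a') = pure K A A a (a' \<otimes>\<^bsub>A\<^esub> c)"
  unfolding ract_def
  by (rule tlift_lin[OF mA mA mAA ract_aux] tlift_pure[OF mA mA mAA ract_aux]; assumption)+

lemma mul_lact:
  assumes c: "c \<in> carrier A" and t: "t \<in> carrier (AA K A)"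
  shows "mul K A (lact K A c t) = c \<otimes>\<^bsub>A\<^esub> mul K A t"
  by (rule tensor_lin_eqI[OF mA mA mA lin_comp[OF lact_lin[OF c] mul_lin]
        lin_comp[OF mul_lin bilin_right[OF mult_A_bilin c]] _ t])
    (simp add: c lact_pure mul_pure Ar.m_assoc)

lemma mul_ract:
  assumes c: "c \<in> carrier A" and t: "t \<in> carrier (AA K A)"
  shows "mul K A (ract K A c t) = mul K A t \<otimes>\<^bsub>A\<^esub> c"
  by (rule tensor_lin_eqI[OF mA mA mA lin_comp[OF ract_lin[OF c] mul_lin]
        lin_comp[OF mul_lin bilin_left[OF mult_A_bilin c]] _ t])
    (simp add: c ract_pure mul_pure Ar.m_assoc)

lemma Omega_u_submodule: "submodule (Omega_u K A) K (AA K A)"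
  unfolding Omega_u_def by (rule submodule_kernel[OF mAA mA mul_lin])

section \<open>Left and right multiplication on \<open>A \<otimes> H\<^sup>+\<close>\<close>

definition lactP :: "'a \<Rightarrow> ('k, 'a, 'h) tens \<Rightarrow> ('k, 'a, 'h) tens"
  where "lactP c = tlift K A P AP (\<lambda>x h. pure K A P (c \<otimes>\<^bsub>A\<^esub> x) h)"

lemma lactP_lin: "c \<in> carrier A \<Longrightarrow> lactP c \<in> lin K AP AP"
  unfolding lactP_def by (rule tlift_lin[OF mA mP mAP lmult_bilin[OF _ mP]])

lemma lactP_pure: "c \<in> carrier A \<Longrightarrow> x \<in> carrier A \<Longrightarrow> h \<in> aug K H \<Longrightarrow>
    lactP c (pure K A P x h) = pure K A P (c \<otimes>\<^bsub>A\<^esub> x) h"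
  unfolding lactP_def by (rule tlift_pure[OF mA mP mAP lmult_bilin[OF _ mP]]) auto

lemma ver_leg_lact:
  assumes c: "c \<in> carrier A" and a: "a \<in> carrier A" and u: "u \<in> carrier AH"
  shows "ver_leg (c \<otimes>\<^bsub>A\<^esub> a) u = lactP c (ver_leg a u)"
  by (rule tensor_lin_eqI[OF mA mH mAP bilin_right[OF ver_leg_bilin]
        lin_comp[OF bilin_right[OF ver_leg_bilin a] lactP_lin[OF c]] _ u])
    (simp_all add: c a ver_leg_pure lactP_pure plus_part_closed Ar.m_assoc)

lemma ver_u_lact:
  assumes c: "c \<in> carrier A" and t: "t \<in> carrier (AA K A)"
  shows "ver_u K H A (lact K A c t) = lactP c (ver_u K H A t)"
  by (rule tensor_lin_eqI[OF mA mA mAP lin_comp[OF lact_lin[OF c] ver_u_lin]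
        lin_comp[OF ver_u_lin lactP_lin[OF c]] _ t])
    (simp add: c lact_pure ver_u_pure ver_leg_lact coact_closed)

text \<open>Together with \<open>ractP\<close> this is the right action
  \<open>(x \<otimes> h)(x' \<otimes> h') = xx' \<otimes> hh'\<close> of
  \<open>A \<otimes> H\<close> on \<open>A \<otimes> H\<^sup>+\<close>. The acting element
  \<open>v\<close> is the first argument so that it can be the parameter of
  \<open>tlift_param_bilin\<close>.\<close>

definition ractP_leg :: "('k, 'a, 'h) tens \<Rightarrow> 'a \<Rightarrow> 'h \<Rightarrow> ('k, 'a, 'h) tens"
  where "ractP_leg v x h = tlift K A H AP (\<lambda>x' h'. pure K A P (x \<otimes>\<^bsub>A\<^esub> x') (h \<otimes>\<^bsub>H\<^esub> h')) v"

definition ractP :: "('k, 'a, 'h) tens \<Rightarrow> ('k, 'a, 'h) tens \<Rightarrow> ('k, 'a, 'h) tens"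
  where "ractP v = tlift K A P AP (ractP_leg v)"

lemma ractP_aux:
  assumes "x \<in> carrier A" "h \<in> aug K H"
  shows "bilin K A H AP (\<lambda>x' h'. pure K A P (x \<otimes>\<^bsub>A\<^esub> x') (h \<otimes>\<^bsub>H\<^esub> h'))"
  using assms
  by (intro bilin_comp[OF pure_AP_bilin bilin_right[OF mult_A_bilin] bilin_right[OF mult_P_bilin]]) auto

lemma ractP_leg_lin: "x \<in> carrier A \<Longrightarrow> h \<in> aug K H \<Longrightarrow> (\<lambda>v. ractP_leg v x h) \<in> lin K AH AP"
  unfolding ractP_leg_def by (rule tlift_lin[OF mA mH mAP ractP_aux])

lemma ractP_leg_pure:
  "x \<in> carrier A \<Longrightarrow> h \<in> aug K H \<Longrightarrow> x' \<in> carrier A \<Longrightarrow> h' \<in> carrier H \<Longrightarrow>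
    ractP_leg (pure K A H x' h') x h = pure K A P (x \<otimes>\<^bsub>A\<^esub> x') (h \<otimes>\<^bsub>H\<^esub> h')"
  unfolding ractP_leg_def by (rule tlift_pure[OF mA mH mAP ractP_aux])

lemma ractP_leg_bilin:
  assumes v: "v \<in> carrier AH"
  shows "bilin K A P AP (ractP_leg v)"
  unfolding bilin_def ractP_leg_def
proof (intro conjI ballI)
  fix x assume x: "x \<in> carrier A"
  show "(\<lambda>h. tlift K A H AP (\<lambda>x' h'. pure K A P (x \<otimes>\<^bsub>A\<^esub> x') (h \<otimes>\<^bsub>H\<^esub> h')) v) \<in> lin K P AP"
    by (rule tlift_param_lin[OF mA mH mAP mP _ _ v])
      (use x in \<open>auto intro!: ractP_aux lin_comp[OF bilin_left[OF mult_P_bilin] bilin_right[OF pure_AP_bilin]]\<close>)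
next
  fix h assume h: "h \<in> carrier P"
  then show "(\<lambda>x. tlift K A H AP (\<lambda>x' h'. pure K A P (x \<otimes>\<^bsub>A\<^esub> x') (h \<otimes>\<^bsub>H\<^esub> h')) v) \<in> lin K A AP"
    by (intro tlift_param_lin[OF mA mH mAP mA _ _ v])
      (auto intro!: ractP_aux aug_mult lin_comp[OF bilin_left[OF mult_A_bilin] bilin_left[OF pure_AP_bilin]])
qed

lemma ractP_bilin: "bilin K AH AP AP ractP"
  unfolding ractP_def
  by (rule tlift_param_bilin[OF mA mP mAP mAH ractP_leg_bilin]) (auto intro: ractP_leg_lin)

lemma ractP_pure: "v \<in> carrier AH \<Longrightarrow> x \<in> carrier A \<Longrightarrow> h \<in> aug K H \<Longrightarrow>
    ractP v (pure K A P x h) = ractP_leg v x h"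
  unfolding ractP_def by (rule tlift_pure[OF mA mP mAP ractP_leg_bilin]) auto

text \<open>The inner lift of the product of \<open>A \<otimes> H\<close>, parallel to
  \<open>ractP_leg\<close> but with \<open>h\<close> in all of \<open>H\<close> and values in
  \<open>A \<otimes> H\<close>. Having both in the same shape lets the two products be compared leg
  by leg.\<close>

definition tmult_leg :: "('k, 'a, 'h) tens \<Rightarrow> 'a \<Rightarrow> 'h \<Rightarrow> ('k, 'a, 'h) tens"
  where "tmult_leg v x h = tlift K A H AH (\<lambda>x' h'. pure K A H (x \<otimes>\<^bsub>A\<^esub> x') (h \<otimes>\<^bsub>H\<^esub> h')) v"

lemma tmult_aux:
  assumes "x \<in> carrier A" "h \<in> carrier H"
  shows "bilin K A H AH (\<lambda>x' h'. pure K A H (x \<otimes>\<^bsub>A\<^esub> x') (h \<otimes>\<^bsub>H\<^esub> h'))"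
  using assms
  by (intro bilin_comp[OF pure_bilin[OF mA mH] bilin_right[OF mult_A_bilin] bilin_right[OF mult_H_bilin]]) auto

lemma tmult_leg_lin: "x \<in> carrier A \<Longrightarrow> h \<in> carrier H \<Longrightarrow> (\<lambda>v. tmult_leg v x h) \<in> lin K AH AH"
  unfolding tmult_leg_def by (rule tlift_lin[OF mA mH mAH tmult_aux])

lemma tmult_leg_pure:
  "x \<in> carrier A \<Longrightarrow> h \<in> carrier H \<Longrightarrow> x' \<in> carrier A \<Longrightarrow> h' \<in> carrier H \<Longrightarrow>
    tmult_leg (pure K A H x' h') x h = pure K A H (x \<otimes>\<^bsub>A\<^esub> x') (h \<otimes>\<^bsub>H\<^esub> h')"
  unfolding tmult_leg_def by (rule tlift_pure[OF mA mH mAH tmult_aux])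

lemma tmult_leg_bilin:
  assumes v: "v \<in> carrier AH"
  shows "bilin K A H AH (tmult_leg v)"
  unfolding bilin_def tmult_leg_def
proof (intro conjI ballI)
  fix x assume x: "x \<in> carrier A"
  show "(\<lambda>h. tlift K A H AH (\<lambda>x' h'. pure K A H (x \<otimes>\<^bsub>A\<^esub> x') (h \<otimes>\<^bsub>H\<^esub> h')) v) \<in> lin K H AH"
    by (rule tlift_param_lin[OF mA mH mAH mH _ _ v])
      (use x in \<open>auto intro!: tmult_aux lin_comp[OF bilin_left[OF mult_H_bilin] bilin_right[OF pure_bilin[OF mA mH]]]\<close>)
next
  fix h assume h: "h \<in> carrier H"
  then show "(\<lambda>x. tlift K A H AH (\<lambda>x' h'. pure K A H (x \<otimes>\<^bsub>A\<^esub> x') (h \<otimes>\<^bsub>H\<^esub> h')) v) \<in> lin K A AH"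
    by (intro tlift_param_lin[OF mA mH mAH mA _ _ v])
      (auto intro!: tmult_aux lin_comp[OF bilin_left[OF mult_A_bilin] bilin_left[OF pure_bilin[OF mA mH]]])
qed

lemma tmult_alt: "tmult K A H u v = tlift K A H AH (tmult_leg v) u"
  unfolding tmult_def Let_def tmult_leg_def ..

lemma tmult_lin: "v \<in> carrier AH \<Longrightarrow> (\<lambda>u. tmult K A H u v) \<in> lin K AH AH"
  unfolding tmult_alt by (rule tlift_lin[OF mA mH mAH tmult_leg_bilin])

lemma tmult_pure: "v \<in> carrier AH \<Longrightarrow> x \<in> carrier A \<Longrightarrow> h \<in> carrier H \<Longrightarrow>
    tmult K A H (pure K A H x h) v = tmult_leg v x h"
  unfolding tmult_alt by (rule tlift_pure[OF mA mH mAH tmult_leg_bilin])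

section \<open>The vertical map on right multiples\<close>

abbreviation (input) "counit_leg \<equiv> tlift K A H A (\<lambda>x h. counit H h \<odot>\<^bsub>A\<^esub> x)"

lemma counit_leg_aux: "bilin K A H A (\<lambda>x h. counit H h \<odot>\<^bsub>A\<^esub> x)"
  unfolding bilin_def
  by (intro conjI ballI linI)
    (simp_all add: counit_closed counit_add counit_smult A.smult_l_distr A.smult_r_distr
      A.smult_assoc1[symmetric] H.R.m_comm)

lemmas counit_leg_lin = tlift_lin[OF mA mH mA counit_leg_aux]
lemmas counit_leg_pure = tlift_pure[OF mA mH mA counit_leg_aux]

lemma smult_mult_A:
  assumes "c \<in> carrier K" "x \<in> carrier A" "y \<in> carrier A"
  shows "(c \<odot>\<^bsub>A\<^esub> x) \<otimes>\<^bsub>A\<^esub> y = c \<odot>\<^bsub>A\<^esub> (x \<otimes>\<^bsub>A\<^esub> y)" "x \<otimes>\<^bsub>A\<^esub> (c \<odot>\<^bsub>A\<^esub> y) = c \<odot>\<^bsub>A\<^esub> (x \<otimes>\<^bsub>A\<^esub> y)"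
  using A assms by (simp_all add: comodule_algebra_def k_algebra_def)

text \<open>This is \<open>(gh)\<^sup>+ = g\<^sup>+ h + \<epsilon>(g) h\<^sup>+\<close> in the second leg.\<close>

lemma ver_leg_tmult:
  assumes a: "a \<in> carrier A" and u: "u \<in> carrier AH" and v: "v \<in> carrier AH"
  shows "ver_leg a (tmult K A H u v) = ractP v (ver_leg a u) \<oplus>\<^bsub>AP\<^esub> ver_leg (a \<otimes>\<^bsub>A\<^esub> counit_leg u) v"
proof (rule tensor_lin_eqI[OF mA mH mAP lin_comp[OF tmult_lin[OF v] bilin_right[OF ver_leg_bilin a]]
        lin_plus[OF mAP lin_comp[OF bilin_right[OF ver_leg_bilin a] bilin_right[OF ractP_bilin v]]
          lin_comp[OF lin_comp[OF counit_leg_lin bilin_right[OF mult_A_bilin a]]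
            bilin_left[OF ver_leg_bilin v]]] _ u])
  fix x g assume x: "x \<in> carrier A" and g: "g \<in> carrier H"
  let ?e = "counit H g"
  have e: "?e \<in> carrier K" using g by (rule counit_closed)
  have ax: "a \<otimes>\<^bsub>A\<^esub> x \<in> carrier A" "a \<otimes>\<^bsub>A\<^esub> (?e \<odot>\<^bsub>A\<^esub> x) \<in> carrier A" using a x e by simp_all
  have gp: "plus_part H g \<in> aug K H" using g by (rule plus_part_closed)
  \<comment> \<open>\<open>u\<close> has been reduced to \<open>x \<otimes> g\<close>; with these
    held fixed, \<open>v\<close> is now reduced to a pure \<open>y \<otimes> h\<close>.\<close>
  have "ver_leg a (tmult_leg v x g)
      = ractP_leg v (a \<otimes>\<^bsub>A\<^esub> x) (plus_part H g) \<oplus>\<^bsub>AP\<^esub> ver_leg (a \<otimes>\<^bsub>A\<^esub> (?e \<odot>\<^bsub>A\<^esub> x)) v"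
  proof (rule tensor_lin_eqI[OF mA mH mAP lin_comp[OF tmult_leg_lin[OF x g] bilin_right[OF ver_leg_bilin a]]
        lin_plus[OF mAP ractP_leg_lin[OF ax(1) gp] bilin_right[OF ver_leg_bilin ax(2)]] _ v])
    fix y h assume y: "y \<in> carrier A" and h: "h \<in> carrier H"
    have hp: "plus_part H h \<in> carrier P" using plus_part_closed[OF h] by simp
    have axy: "a \<otimes>\<^bsub>A\<^esub> x \<otimes>\<^bsub>A\<^esub> y \<in> carrier A" using a x y by simp
    have gh: "plus_part H g \<otimes>\<^bsub>H\<^esub> h \<in> carrier P" using aug_mult[OF gp h] by simp
    have eh: "?e \<odot>\<^bsub>H\<^esub> plus_part H h \<in> carrier P"
      using module.smult_closed[OF mP e hp] by simp
    note r = bilin_right[OF pure_AP_bilin axy] and l = bilin_left[OF pure_AP_bilin hp]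
    have "ver_leg a (tmult_leg (pure K A H y h) x g)
        = pure K A P (a \<otimes>\<^bsub>A\<^esub> x \<otimes>\<^bsub>A\<^esub> y) (plus_part H g \<otimes>\<^bsub>H\<^esub> h \<oplus>\<^bsub>H\<^esub> ?e \<odot>\<^bsub>H\<^esub> plus_part H h)"
      using a x y g h by (simp add: tmult_leg_pure ver_leg_pure plus_part_mult Ar.m_assoc)
    also have "\<dots> = pure K A P (a \<otimes>\<^bsub>A\<^esub> x \<otimes>\<^bsub>A\<^esub> y) (plus_part H g \<otimes>\<^bsub>H\<^esub> h)
        \<oplus>\<^bsub>AP\<^esub> pure K A P (a \<otimes>\<^bsub>A\<^esub> x \<otimes>\<^bsub>A\<^esub> y) (?e \<odot>\<^bsub>H\<^esub> plus_part H h)"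
      using lin_add[OF r gh eh] by simp
    \<comment> \<open>The scalar \<open>\<epsilon>(g)\<close> moves across the tensor sign onto the
      leg in \<open>A\<close>, where it meets \<open>x\<close> and forms the value of
      \<open>counit_leg\<close> at \<open>x \<otimes> g\<close>.\<close>
    also have "pure K A P (a \<otimes>\<^bsub>A\<^esub> x \<otimes>\<^bsub>A\<^esub> y) (?e \<odot>\<^bsub>H\<^esub> plus_part H h)
        = pure K A P (?e \<odot>\<^bsub>A\<^esub> (a \<otimes>\<^bsub>A\<^esub> x \<otimes>\<^bsub>A\<^esub> y)) (plus_part H h)"
      using lin_smult[OF r e hp] lin_smult[OF l e axy] by simp
    finally show "ver_leg a (tmult_leg (pure K A H y h) x g)
        = ractP_leg (pure K A H y h) (a \<otimes>\<^bsub>A\<^esub> x) (plus_part H g)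
          \<oplus>\<^bsub>AP\<^esub> ver_leg (a \<otimes>\<^bsub>A\<^esub> (?e \<odot>\<^bsub>A\<^esub> x)) (pure K A H y h)"
      using a x y e h gp by (simp add: ractP_leg_pure ver_leg_pure smult_mult_A)
  qed
  then show "ver_leg a (tmult K A H (pure K A H x g) v)
      = ractP v (ver_leg a (pure K A H x g))
        \<oplus>\<^bsub>AP\<^esub> ver_leg (a \<otimes>\<^bsub>A\<^esub> counit_leg (pure K A H x g)) v"
    using a x g v gp by (simp add: tmult_pure ver_leg_pure ractP_pure counit_leg_pure)
qed

text \<open>On \<open>a \<otimes> a'\<close> the coaction is multiplicative, so the product rule for
  \<open>ver_leg\<close> applies with \<open>u = \<delta>(a')\<close>. The counit axiom collapses
  \<open>counit_leg (coact A a')\<close> to \<open>a'\<close>, which turns the correction term into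
  one that depends on \<open>aa' = m(a \<otimes> a')\<close> only.\<close>

lemma ver_u_ract:
  assumes c: "c \<in> carrier A" and t: "t \<in> carrier (AA K A)"
  shows "ver_u K H A (ract K A c t) = ractP (coact A c) (ver_u K H A t) \<oplus>\<^bsub>AP\<^esub> ver_leg (mul K A t) (coact A c)"
proof (rule tensor_lin_eqI[OF mA mA mAP lin_comp[OF ract_lin[OF c] ver_u_lin]
        lin_plus[OF mAP lin_comp[OF ver_u_lin bilin_right[OF ractP_bilin coact_closed[OF c]]]
          lin_comp[OF mul_lin bilin_left[OF ver_leg_bilin coact_closed[OF c]]]] _ t])
  fix a a' assume a: "a \<in> carrier A" and a': "a' \<in> carrier A"
  have "coact A (a' \<otimes>\<^bsub>A\<^esub> c) = tmult K A H (coact A a') (coact A c)" "counit_leg (coact A a') = a'"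
    using A a' c by (simp_all add: comodule_algebra_def)
  then show "ver_u K H A (ract K A c (pure K A A a a'))
      = ractP (coact A c) (ver_u K H A (pure K A A a a'))
        \<oplus>\<^bsub>AP\<^esub> ver_leg (mul K A (pure K A A a a')) (coact A c)"
    using a a' c by (simp add: ract_pure ver_u_pure mul_pure ver_leg_tmult coact_closed)
qed

lemma ver_u_ract_Omega_u:
  assumes c: "c \<in> carrier A" and t: "t \<in> Omega_u K A"
  shows "ver_u K H A (ract K A c t) = ractP (coact A c) (ver_u K H A t)"
proof -
  have t': "t \<in> carrier (AA K A)" "mul K A t = \<zero>\<^bsub>A\<^esub>" using t by (auto simp: Omega_u_def)
  have "ver_leg \<zero>\<^bsub>A\<^esub> (coact A c) = \<zero>\<^bsub>AP\<^esub>"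
    by (rule lin_zero[OF mA mAP bilin_left[OF ver_leg_bilin coact_closed[OF c]]])
  moreover have "ractP (coact A c) (ver_u K H A t) \<in> carrier AP"
    by (rule bilin_closed[OF ractP_bilin coact_closed[OF c] lin_closed[OF ver_u_lin t'(1)]])
  ultimately show ?thesis using ver_u_ract[OF c t'(1)] t'(2) by simp
qed

section \<open>Stability of \<open>A \<otimes> I\<close>\<close>

lemma lactP_tsub:
  assumes c: "c \<in> carrier A" and I: "I \<subseteq> aug K H" and t: "t \<in> tsub K A P (carrier A) I"
  shows "lactP c t \<in> tsub K A P (carrier A) I"
proof -
  have sub: "submodule (tsub K A P (carrier A) I) K AP"
    using I by (intro tsub_submodule mA mP) auto
  have "tsub K A P (carrier A) I \<subseteq> {t \<in> carrier AP. lactP c t \<in> tsub K A P (carrier A) I}"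
    unfolding tsub_def[of K A P "carrier A" I]
    by (rule lspan_least, fold tsub_def, rule submodule_vimage[OF mAP mAP lactP_lin[OF c] sub])
      (use c I in \<open>auto simp: lactP_pure subset_iff intro!: pure_in_tsub pure_closed[OF mA mP]\<close>)
  then show ?thesis using t by blast
qed

text \<open>Two spanning arguments are nested. For a fixed generator \<open>x \<otimes> i\<close>
  and a pure \<open>v = y \<otimes> h\<close> the result is \<open>xy \<otimes> ih\<close>, with
  \<open>ih\<close> in the right ideal; this extends first to arbitrary \<open>v\<close>, then to
  the span of the generators.\<close>

lemma ractP_tsub:
  assumes v: "v \<in> carrier AH" and I: "right_ideal H I" "I \<subseteq> aug K H"
    and t: "t \<in> tsub K A P (carrier A) I"
  shows "ractP v t \<in> tsub K A P (carrier A) I"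
proof -
  let ?T = "tsub K A P (carrier A) I"
  have sub: "submodule ?T K AP"
    using I by (intro tsub_submodule mA mP) auto
  have leg: "ractP_leg v x i \<in> ?T" if x: "x \<in> carrier A" and i: "i \<in> I" for x i
  proof -
    have i': "i \<in> aug K H" using i I by auto
    have "v \<in> {v \<in> carrier AH. ractP_leg v x i \<in> ?T}"
    proof (rule tensor_spanned[OF mA mH submodule_vimage[OF mAH mAP ractP_leg_lin[OF x i'] sub] _ v])
      fix y h assume "y \<in> carrier A" "h \<in> carrier H"
      then show "pure K A H y h \<in> {v \<in> carrier AH. ractP_leg v x i \<in> ?T}"
        using x i i' I
        by (auto simp: ractP_leg_pure right_ideal_def intro!: pure_in_tsub pure_closed[OF mA mH])
    qed
    then show ?thesis by simp
  qed
  have "?T \<subseteq> {t \<in> carrier AP. ractP v t \<in> ?T}"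
    unfolding tsub_def[of K A P "carrier A" I]
    by (rule lspan_least, fold tsub_def,
        rule submodule_vimage[OF mAP mAP bilin_right[OF ractP_bilin v] sub])
      (use v I in \<open>auto simp: ractP_pure subset_iff intro!: leg pure_closed[OF mA mP]\<close>)
  then show ?thesis using t by blast
qed

section \<open>Coinvariants and the universal calculus of \<open>B\<close>\<close>

lemma coinv_submodule: "submodule (coinv K H A) K A"
  unfolding coinv_def
  by (rule submodule_equalizer[OF mA mAH coact_lin bilin_left[OF pure_bilin[OF mA mH]]]) simp

text \<open>This makes the multiplication of \<open>A\<close> bilinear on \<open>B\<close> with
  values in \<open>B\<close>, as is required for \<open>mul\<close> on the restricted structure to
  be a genuine lift.\<close>

lemma coinv_mult:
  assumes "b \<in> coinv K H A" "b' \<in> coinv K H A"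
  shows "b \<otimes>\<^bsub>A\<^esub> b' \<in> coinv K H A"
proof -
  have b: "b \<in> carrier A" "b' \<in> carrier A" "coact A b = pure K A H b \<one>\<^bsub>H\<^esub>" "coact A b' = pure K A H b' \<one>\<^bsub>H\<^esub>"
    using assms by (auto simp: coinv_def)
  have "coact A (b \<otimes>\<^bsub>A\<^esub> b') = tmult K A H (coact A b) (coact A b')"
    using A b by (simp add: comodule_algebra_def)
  also have "\<dots> = pure K A H (b \<otimes>\<^bsub>A\<^esub> b') \<one>\<^bsub>H\<^esub>"
    using b by (simp add: tmult_pure tmult_leg_pure pure_closed[OF mA mH])
  finally show ?thesis using b by (simp add: coinv_def)
qed

text \<open>Since \<open>\<delta>(b') = b' \<otimes> 1\<close>, a pure tensor of \<open>B\<close>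
  has vertical part \<open>bb' \<otimes> 1\<^sup>+ = 0\<close>, so \<open>ver_u\<close> vanishes on
  the whole image of \<open>B \<otimes> B\<close>. The kernel condition over \<open>B\<close> gives
  membership in \<open>Omega_u K A\<close>, because the map \<open>?j\<close> into
  \<open>A \<otimes> A\<close> respects multiplication.\<close>

lemma Omega_uB_ver_u:
  assumes "t \<in> Omega_uB K H A"
  shows "t \<in> Omega_u K A" "ver_u K H A t = \<zero>\<^bsub>AP\<^esub>"
proof -
  let ?B = "on_sub A (coinv K H A)"
  let ?j = "tmap K ?B ?B A A id id"
  have mB: "module K ?B" by (rule module_on_sub[OF mA coinv_submodule])
  have BA: "b \<in> carrier A" if "b \<in> coinv K H A" for b using that by (simp add: coinv_def)
  have idB: "id \<in> lin K ?B A" by (auto simp: lin_def BA)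
  have j_aux: "bilin K ?B ?B (AA K A) (\<lambda>x y. pure K A A (id x) (id y))"
    by (rule bilin_comp[OF pure_bilin[OF mA mA] idB idB])
  have j_lin: "?j \<in> lin K (tensor K ?B ?B) (AA K A)"
    unfolding tmap_def by (rule tlift_lin[OF mB mB mAA j_aux])
  have j_pure: "?j (pure K ?B ?B b b') = pure K A A b b'" if "b \<in> carrier ?B" "b' \<in> carrier ?B" for b b'
    unfolding tmap_def using tlift_pure[OF mB mB mAA j_aux that] by simp
  have mulB: "bilin K ?B ?B ?B (\<lambda>x y. x \<otimes>\<^bsub>?B\<^esub> y)"
    using mult_A_bilin by (auto simp: bilin_def lin_def BA coinv_mult)
  \<comment> \<open>The product of \<open>B\<close> is followed by the inclusion into
    \<open>A\<close>, so that it can be compared with \<open>mul K A\<close> after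
    \<open>?j\<close>.\<close>
  have mulB_lin: "mul K ?B \<in> lin K (tensor K ?B ?B) A"
    using lin_comp[OF tlift_lin[OF mB mB mB mulB] idB] by (simp add: mul_def)
  have mulB_pure: "mul K ?B (pure K ?B ?B b b') = b \<otimes>\<^bsub>A\<^esub> b'" if "b \<in> carrier ?B" "b' \<in> carrier ?B" for b b'
    using tlift_pure[OF mB mB mB mulB that] by (simp add: mul_def)
  obtain t' where t': "t' \<in> carrier (tensor K ?B ?B)" "mul K ?B t' = \<zero>\<^bsub>A\<^esub>" "t = ?j t'"
    using assms by (auto simp: Omega_uB_def Let_def Omega_u_def)
  have "mul K A (?j t') = mul K ?B t'"
    by (rule tensor_lin_eqI[OF mB mB mA lin_comp[OF j_lin mul_lin] mulB_lin _ t'(1)])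
      (simp add: j_pure mulB_pure mul_pure BA)
  then show "t \<in> Omega_u K A"
    using t' lin_closed[OF j_lin] by (simp add: Omega_u_def)
  have zero: "(\<lambda>_. \<zero>\<^bsub>AP\<^esub>) \<in> lin K (tensor K ?B ?B) AP"
    by (auto simp: lin_def)
  have "ver_u K H A (?j t') = \<zero>\<^bsub>AP\<^esub>"
  proof (rule tensor_lin_eqI[OF mB mB mAP lin_comp[OF j_lin ver_u_lin] zero _ t'(1)])
    fix b b' assume b: "b \<in> carrier ?B" "b' \<in> carrier ?B"
    have c: "b \<in> carrier A" "b' \<in> carrier A" "coact A b' = pure K A H b' \<one>\<^bsub>H\<^esub>"
      using b by (auto simp: coinv_def)
    have "ver_u K H A (?j (pure K ?B ?B b b')) = pure K A P (b \<otimes>\<^bsub>A\<^esub> b') \<zero>\<^bsub>H\<^esub>"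
      using b c by (simp add: j_pure ver_u_pure ver_leg_pure plus_part_one)
    also have "\<dots> = \<zero>\<^bsub>AP\<^esub>"
      using lin_zero[OF mP mAP bilin_right[OF pure_AP_bilin, of "b \<otimes>\<^bsub>A\<^esub> b'"]] c by simp
    finally show "ver_u K H A (?j (pure K ?B ?B b b')) = \<zero>\<^bsub>AP\<^esub>" .
  qed
  then show "ver_u K H A t = \<zero>\<^bsub>AP\<^esub>" using t' by simp
qed

text \<open>Not the kernel of \<open>ver_u\<close> but the preimage of \<open>A \<otimes> I\<close>:
  the name refers to \<open>ver_u\<close> followed by the quotient map to
  \<open>A \<otimes> H\<^sup>+/I\<close>, which vanishes here.\<close>

definition ver_kernel :: "'h set \<Rightarrow> ('k, 'a, 'a) tens set"
  where "ver_kernel I = {t \<in> Omega_u K A. ver_u K H A t \<in> tsub K A P (carrier A) I}"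

lemma ver_kernel_submodule:
  assumes "I \<subseteq> aug K H"
  shows "submodule (ver_kernel I) K (AA K A)"
proof -
  have sub: "submodule (tsub K A P (carrier A) I) K AP"
    using assms by (intro tsub_submodule mA mP) auto
  have "ver_kernel I = \<Inter>{Omega_u K A, {t \<in> carrier (AA K A). ver_u K H A t \<in> tsub K A P (carrier A) I}}"
    by (auto simp: ver_kernel_def Omega_u_def)
  also have "submodule \<dots> K (AA K A)"
    using Omega_u_submodule submodule_vimage[OF mAA mAP ver_u_lin sub]
    by (intro submodule_Inter[OF mAA]) auto
  finally show ?thesis .
qed

lemma ver_kernel_bimodule:
  assumes I: "right_ideal H I" "I \<subseteq> aug K H" and c: "c \<in> carrier A" and t: "t \<in> ver_kernel I"
  shows "lact K A c t \<in> ver_kernel I" "ract K A c t \<in> ver_kernel I"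
proof -
  have t': "t \<in> Omega_u K A" "t \<in> carrier (AA K A)" "mul K A t = \<zero>\<^bsub>A\<^esub>"
    "ver_u K H A t \<in> tsub K A P (carrier A) I"
    using t by (auto simp: ver_kernel_def Omega_u_def)
  show "lact K A c t \<in> ver_kernel I"
    using c t' lin_closed[OF lact_lin[OF c]]
    by (simp add: ver_kernel_def Omega_u_def mul_lact ver_u_lact lactP_tsub[OF c I(2)])
  show "ract K A c t \<in> ver_kernel I"
    using c t' lin_closed[OF ract_lin[OF c]]
    by (simp add: ver_kernel_def ver_u_ract_Omega_u ractP_tsub[OF coact_closed[OF c] I])
      (simp add: Omega_u_def mul_ract)
qed

text \<open>\<open>ver_kernel I\<close> is itself one of the subbimodules being intersected. That
  gives the inclusion, and it also shows that the family is nonempty, without which the intersection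
  would not be a submodule.\<close>

lemma subbimod_ver_kernel:
  assumes I: "right_ideal H I" "I \<subseteq> aug K H" and X: "X \<subseteq> ver_kernel I"
  shows "submodule (subbimod K A X) K (AA K A)" "subbimod K A X \<subseteq> ver_kernel I"
proof -
  let ?C = "{N. submodule N K (AA K A) \<and>
     (\<forall>c \<in> carrier A. \<forall>t \<in> N. lact K A c t \<in> N \<and> ract K A c t \<in> N) \<and> X \<subseteq> N}"
  have ker: "ver_kernel I \<in> ?C"
    using ver_kernel_submodule[OF I(2)] ver_kernel_bimodule[OF I] X by auto
  then show "subbimod K A X \<subseteq> ver_kernel I" unfolding subbimod_def by (rule Inter_lower)
  show "submodule (subbimod K A X) K (AA K A)"
    unfolding subbimod_def using ker by (intro submodule_Inter[OF mAA]) auto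
qed

lemma ver_kernel_Omega_uB:
  assumes "I \<subseteq> aug K H"
  shows "Omega_uB K H A \<subseteq> ver_kernel I"
proof -
  have "submodule (tsub K A P (carrier A) I) K AP"
    using assms by (intro tsub_submodule mA mP) auto
  then have "\<zero>\<^bsub>AP\<^esub> \<in> tsub K A P (carrier A) I" by (simp add: submodule_iff[OF mAP])
  then show ?thesis using Omega_uB_ver_u by (auto simp: ver_kernel_def)
qed

lemma N_A_ver_kernel:
  assumes I: "right_ideal H I" "I \<subseteq> aug K H" and s: "s ` conn_hull K H A I \<omega> \<subseteq> ver_kernel I"
  shows "submodule (N_A K H A I \<omega> s) K (AA K A)" "N_A K H A I \<omega> s \<subseteq> ver_kernel I"
proof -
  note 1 = subbimod_ver_kernel[OF I s] and 2 = subbimod_ver_kernel[OF I ver_kernel_Omega_uB[OF I(2)]]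
  show "submodule (N_A K H A I \<omega> s) K (AA K A)"
    unfolding N_A_def by (rule submodule_set_add[OF mAA 1(1) 2(1)])
  show "N_A K H A I \<omega> s \<subseteq> ver_kernel I"
    using 1(2) 2(2) ver_kernel_submodule[OF I(2)]
    unfolding N_A_def set_add_def' submodule_iff[OF mAA] by blast
qed

text \<open>The witness is the \<open>qlift\<close> of \<open>ver_u\<close> followed by
  \<open>id \<otimes> q\<close>. On \<open>N\<close> the vertical part lies in
  \<open>A \<otimes> I\<close>, which \<open>id \<otimes> q\<close> annihilates, so the composite is
  constant on cosets. \<open>\<omega>\<close> supplies preimages of \<open>1 \<otimes> h\<close>,
  and left multiplication by \<open>A\<close> reaches the other pure tensors.\<close>

lemma vertical_map_descends:
  assumes I: "right_ideal H I" "I \<subseteq> aug K H"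
    and N: "submodule N K (AA K A)" "N \<subseteq> ver_kernel I"
    and \<omega>: "\<And>h. h \<in> aug K H \<Longrightarrow> \<omega> h \<in> Omega_u K A"
      "\<And>h. h \<in> aug K H \<Longrightarrow> ver_u K H A (\<omega> h) = pure K A P \<one>\<^bsub>A\<^esub> h"
  defines "\<Omega>A \<equiv> on_sub (AA K A) (Omega_u K A)"
  shows "\<exists>ver \<in> lin K (quot \<Omega>A N) (tensor K A (quot P I)).
      (\<forall>x \<in> carrier \<Omega>A.
         ver (qmap \<Omega>A N x) = tmap K A P A (quot P I) id (qmap P I) (ver_u K H A x)) \<and>
      ver ` carrier (quot \<Omega>A N) = carrier (tensor K A (quot P I))"
proof -
  let ?PI = "quot P I" and ?Q = "tmap K A P A (quot P I) id (qmap P I)"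
  let ?f = "\<lambda>x. ?Q (ver_u K H A x)"
  have subI: "submodule I K P" by (rule right_ideal_submodule[OF I])
  have mPI: "module K ?PI" by (rule quot_module[OF mP subI])
  have mAPI: "module K (tensor K A ?PI)" by (rule tensor_module[OF mA mPI])
  have Q_aux: "bilin K A P (tensor K A ?PI) (\<lambda>x y. pure K A ?PI (id x) (qmap P I y))"
    by (rule bilin_comp[OF pure_bilin[OF mA mPI] lin_id qmap_lin[OF mP subI]])
  have Q_lin: "?Q \<in> lin K AP (tensor K A ?PI)"
    unfolding tmap_def by (rule tlift_lin[OF mA mP mAPI Q_aux])
  have Q_pure: "?Q (pure K A P x h) = pure K A ?PI x (qmap P I h)" if "x \<in> carrier A" "h \<in> carrier P" for x h
    unfolding tmap_def using tlift_pure[OF mA mP mAPI Q_aux that] by simp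
  have "tsub K A P (carrier A) I \<subseteq> {t \<in> carrier AP. ?Q t = \<zero>\<^bsub>tensor K A ?PI\<^esub>}"
    unfolding tsub_def
  proof (rule lspan_least[OF submodule_kernel[OF mAP mAPI Q_lin]], rule subsetI)
    fix t assume "t \<in> {pure K A P x i | x i. x \<in> carrier A \<and> i \<in> I}"
    then obtain x i where t: "t = pure K A P x i" and x: "x \<in> carrier A" and i: "i \<in> I" by blast
    have i': "i \<in> carrier P" using i I by auto
    have mem: "pure K A P x i \<in> carrier AP" by (rule pure_closed[OF mA mP x i'])
    have "?Q (pure K A P x i) = pure K A ?PI x \<zero>\<^bsub>?PI\<^esub>"
      using Q_pure[OF x i'] qmap_eq_zero[OF mP subI i] by simp
    also have "\<dots> = \<zero>\<^bsub>tensor K A ?PI\<^esub>"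
      by (rule lin_zero[OF mPI mAPI bilin_right[OF pure_bilin[OF mA mPI] x]])
    finally have "?Q (pure K A P x i) = \<zero>\<^bsub>tensor K A ?PI\<^esub>" .
    then show "t \<in> {t \<in> carrier AP. ?Q t = \<zero>\<^bsub>tensor K A ?PI\<^esub>}"
      unfolding t using mem by (intro CollectI conjI)
  qed
  then have Q_tsub: "?Q t = \<zero>\<^bsub>tensor K A ?PI\<^esub>" if "t \<in> tsub K A P (carrier A) I" for t
    using that by auto
  have m\<Omega>: "module K \<Omega>A"
    unfolding \<Omega>A_def by (rule module_on_sub[OF mAA Omega_u_submodule])
  \<comment> \<open>The operations on \<open>\<Omega>A\<close> are those of
    \<open>A \<otimes> A\<close>; the new information is that \<open>N\<close> lies inside
    \<open>Omega_u K A\<close>.\<close>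
  have subN: "submodule N K \<Omega>A"
    using N unfolding submodule_iff[OF m\<Omega>] submodule_iff[OF mAA]
    by (auto simp: \<Omega>A_def ver_kernel_def)
  have f_lin: "?f \<in> lin K \<Omega>A (tensor K A ?PI)"
    unfolding \<Omega>A_def
    by (rule lin_on_sub[OF Omega_u_submodule mAA lin_comp[OF ver_u_lin Q_lin]])
  have fN: "?f x = \<zero>\<^bsub>tensor K A ?PI\<^esub>" if "x \<in> N" for x
    using that N(2) by (intro Q_tsub) (auto simp: ver_kernel_def)
  note lift_qmap = qlift_qmap[OF m\<Omega> subN mAPI f_lin fN]
  note lift_lin = qlift_lin[OF m\<Omega> subN mAPI f_lin fN]
  \<comment> \<open>The image of a linear map is a submodule, so hitting each pure
    \<open>x \<otimes> [h]\<close> suffices.\<close>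
  have onto: "t \<in> ?f ` carrier \<Omega>A" if t: "t \<in> carrier (tensor K A ?PI)" for t
  proof (rule tensor_spanned[OF mA mPI submodule_image[OF m\<Omega> mAPI f_lin] _ t])
    fix x y assume x: "x \<in> carrier A" and "y \<in> carrier ?PI"
    then obtain h where h: "h \<in> aug K H" "y = qmap P I h"
      using quot_sel(1)[OF mP subI] by auto
    have \<omega>h: "\<omega> h \<in> carrier (AA K A)" "mul K A (\<omega> h) = \<zero>\<^bsub>A\<^esub>"
      using \<omega>(1)[OF h(1)] by (auto simp: Omega_u_def)
    have "ver_u K H A (lact K A x (\<omega> h)) = pure K A P x h"
      using x h \<omega>h \<omega>(2) by (simp add: ver_u_lact lactP_pure)
    then have "?f (lact K A x (\<omega> h)) = pure K A ?PI x y"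
      using Q_pure x h by simp
    \<comment> \<open>The preimage is still a 1-form:
      \<open>m(x \<omega>(h)) = x m(\<omega>(h)) = 0\<close>.\<close>
    moreover have "lact K A x (\<omega> h) \<in> carrier \<Omega>A"
      using x \<omega>h lin_closed[OF lact_lin[OF x]] by (simp add: \<Omega>A_def Omega_u_def mul_lact)
    ultimately show "pure K A ?PI x y \<in> ?f ` carrier \<Omega>A" by (metis (no_types, lifting) imageI)
  qed
  have "qlift \<Omega>A N ?f ` carrier (quot \<Omega>A N) = ?f ` carrier \<Omega>A"
    unfolding quot_sel(1)[OF m\<Omega> subN] image_image by (rule image_cong) (simp_all add: lift_qmap)
  also have "\<dots> = carrier (tensor K A ?PI)"
    using onto lin_closed[OF f_lin] by blast
  finally show ?thesis
    using lift_lin lift_qmap by blast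
qed

end

end

theorem proposition3p10:
  fixes K :: "('k, 'm) ring_scheme"
    and H :: "('k, 'h) hopf"
    and A :: "('k, 'h, 'a) comod_alg"
    and I :: "'h set"
    and l \<omega> :: "'h \<Rightarrow> ('k, 'a, 'a) tens"
    and s :: "('k, 'a, 'a) tens set \<Rightarrow> ('k, 'a, 'a) tens"
  defines "\<Omega>A \<equiv> on_sub (tensor K A A) (Omega_u K A)"
    and "N \<equiv> N_A K H A I \<omega> s"
    and "W \<equiv> conn_hull K H A I \<omega>"
  assumes "field K"
    and "hopf_algebra K H"
    and "bij_betw (antipode H) (carrier H) (carrier H)"
    and "principal_comodule_algebra K H A"
    and "right_ideal H I" "I \<subseteq> aug K H" "Ad_invariant K H I"
    and "associated_form K H A l \<omega>"
    and "colinear_splitting K H A s" "s ` W \<subseteq> Omega_u K A"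
    and "ver_u K H A ` s ` W \<subseteq> tsub K A (Hplus K H) (carrier A) I"
  shows "\<exists>ver \<in> lin K (quot \<Omega>A N) (tensor K A (quot (Hplus K H) I)).
      (\<forall>x \<in> carrier \<Omega>A.
         ver (qmap \<Omega>A N x) =
         tmap K A (Hplus K H) A (quot (Hplus K H) I) id (qmap (Hplus K H) I) (ver_u K H A x)) \<and>
      ver ` carrier (quot \<Omega>A N) = carrier (tensor K A (quot (Hplus K H) I))"
proof -
  have H: "bialgebra K H" and A: "comodule_algebra K H A"
    using assms by (simp_all add: hopf_algebra_def principal_comodule_algebra_def)
  \<comment> \<open>Membership in \<open>ver_kernel\<close> is the conjunction of the two hypotheses
    on the image of the hull under \<open>s\<close>: values in \<open>Omega_u K A\<close>, and
    vertical parts in \<open>A \<otimes> I\<close>.\<close>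
  have "s ` conn_hull K H A I \<omega> \<subseteq> ver_kernel K H A I"
    using assms by (auto simp: ver_kernel_def[OF H A])
  note N = N_A_ver_kernel[OF H A \<open>right_ideal H I\<close> \<open>I \<subseteq> aug K H\<close> this, folded N_def]
  have \<omega>: "connection_form K H A \<omega>" using assms by (simp add: associated_form_def)
  show ?thesis
    unfolding \<Omega>A_def
    by (rule vertical_map_descends[OF H A \<open>right_ideal H I\<close> \<open>I \<subseteq> aug K H\<close> N, of \<omega>])
      (use \<omega> in \<open>auto simp: connection_form_def lin_def\<close>)
qed

end
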